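(* (Intermediate regime.) Let $\alpha=1$, $\Delta>0$, $\mu>0$, $t>0$, let $\rho(t):=\frac{\mathbb{E}\Lambda}{\mu}(1-e^{-\mu t})$ and let $a>\rho(t)$. With $M(\theta):=\mathbb{E}\,e^{\theta\Lambda}$ and $M^{(N)}(t)$ the queue length at time $t$ in the $N$-scaled system defined in the context, $$\lim_{N\to\infty}\Delta N^{-1}\log\mathbb{P}\Big(\frac{M^{(N)}(t)}{N}\ge a\Big)=-\sup_{\theta>0}\Big(\theta a-\int_0^t\log M\big(\Delta(e^{\theta/\Delta}-1)e^{-\mu s}\big)\,\mathrm{d}s\Big).$$
   Context: $\Lambda$ is a non-negative random variable with a density, finite first two moments, and $M(\theta)=\mathbb{E}\,e^{\theta\Lambda}<\infty$ for some $\theta>0$; $\Lambda_0,\Lambda_1,\dots$ are i.i.d. copies of $\Lambda$. Define (with $\alpha=1$) $$\Lambda^{(N)}(s):=\sum_{j=0}^\infty \Lambda_j\,1_{[j\Delta N^{-1},(j+1)\Delta N^{-1})}(s),\qquad \kappa_t(\Lambda^{(N)}):=\int_0^t\Lambda^{(N)}(s)\,e^{-\mu s}\,\mathrm{d}s .$$ $M^{(N)}(t)$, the number of jobs at time $t$ in an initially empty infinite-server queue with exponential service times of mean $1/\mu$ and random arrival rate $N\Lambda^{(N)}(\cdot)$, is the mixed Poisson random variable that, conditionally on $(\Lambda_j)_j$, is Poisson with parameter $N\kappa_t(\Lambda^{(N)})$. *)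

theory Defs
  imports "HOL-Probability.Probability"
begin

definition arrival_rate :: "real \<Rightarrow> nat \<Rightarrow> (nat \<Rightarrow> real) \<Rightarrow> real \<Rightarrow> real" where
  "arrival_rate \<Delta> N x s =
     (\<Sum>j. x j * indicator {real j * \<Delta> / real N ..< (real j + 1) * \<Delta> / real N} s)"

definition kappa :: "real \<Rightarrow> real \<Rightarrow> real \<Rightarrow> nat \<Rightarrow> (nat \<Rightarrow> real) \<Rightarrow> real" where
  "kappa \<mu> t \<Delta> N x =
     set_lebesgue_integral lborel {0..t} (\<lambda>s. arrival_rate \<Delta> N x s * exp (- \<mu> * s))"

definition sigma_generated :: "'a measure \<Rightarrow> (nat \<Rightarrow> 'a \<Rightarrow> real) \<Rightarrow> 'a measure" where
  "sigma_generated P X =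
     vimage_algebra (space P) (\<lambda>\<omega> j. X j \<omega>) (\<Pi>\<^sub>M j\<in>UNIV. borel)"

(* "poisson_pmf r" is only specified for r > 0; for the queue below the random
   parameter is almost surely positive, because the density excludes an atom at 0. *)
definition cond_poisson ::
    "'a measure \<Rightarrow> (nat \<Rightarrow> 'a \<Rightarrow> real) \<Rightarrow> ('a \<Rightarrow> real) \<Rightarrow> ('a \<Rightarrow> nat) \<Rightarrow> bool" where
  "cond_poisson P X R Q \<longleftrightarrow>
     Q \<in> measurable P (count_space UNIV) \<and>
     (\<forall>k. AE \<omega> in P.
        real_cond_exp P (sigma_generated P X) (indicator {\<omega> \<in> space P. Q \<omega> = k}) \<omega>
          = pmf (poisson_pmf (R \<omega>)) k)"

definition mgf :: "'a measure \<Rightarrow> ('a \<Rightarrow> real) \<Rightarrow> real \<Rightarrow> ennreal" where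
  "mgf P X \<theta> = (\<integral>\<^sup>+\<omega>. ennreal (exp (\<theta> * X \<omega>)) \<partial>P)"

definition elog :: "ennreal \<Rightarrow> ereal" where
  "elog x = (if x = 0 then -\<infinity> else if x = \<top> then \<infinity> else ereal (ln (enn2real x)))"

(* The integral of log M(...) over [0,t], possibly infinite. For \<theta> > 0 the argument of M is
   positive, so M(...) \<ge> 1 and e2ennreal does not truncate anything. *)
definition log_mgf_integral ::
    "'a measure \<Rightarrow> ('a \<Rightarrow> real) \<Rightarrow> real \<Rightarrow> real \<Rightarrow> real \<Rightarrow> real \<Rightarrow> ereal" where
  "log_mgf_integral P X \<mu> t \<Delta> \<theta> =
     enn2ereal (\<integral>\<^sup>+s\<in>{0..t}.
       e2ennreal (elog (mgf P X (\<Delta> * (exp (\<theta> / \<Delta>) - 1) * exp (- \<mu> * s)))) \<partial>lborel)"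

end

theory Submission
  imports Defs
begin

text \<open>
  Given the rates, the queue length is Poisson, with a parameter that is a weighted sum of the rates of
  the slots of length \<open>\<delta> = \<Delta> / N\<close>; the weight of a slot is the mean of \<open>exp (- \<mu> s)\<close> over it, up
  to the factor \<open>\<Delta>\<close> (\<open>kappa_eq_sum\<close>). The moment generating function of the queue at \<open>\<theta> / \<Delta>\<close> is
  therefore a product over the slots of \<open>M(c w)\<close>, where \<open>w\<close> is the slot mean and
  \<open>c = \<Delta> (exp (\<theta> / \<Delta>) - 1)\<close> (\<open>queue_restricted_mgf\<close>), and \<open>\<delta>\<close> times its logarithm is a Riemann sum for
  \<open>L(\<theta>) = \<integral> log M(c exp (- \<mu> s)) ds\<close> over \<open>[0, t]\<close> (\<open>slot_sum_tendsto_integral\<close>). The exponential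
  Markov inequality gives the upper bound (\<open>limsup_scaled_log_tail\<close>).

  For the lower bound one wants to tilt at the maximiser of \<open>\<theta> a - L(\<theta>)\<close>. It need not be a
  stationary point: \<open>M\<close> may be finite at the end of its domain, and for large \<open>a\<close> the supremum is then
  attained at that end with \<open>L' < a\<close>. As in the general form of Cramer's theorem the remedy is
  truncation. On the event that all rates are at most \<open>K\<close> the same computation holds with
  \<open>M\<^sub>K(y) = E(exp (y \<Lambda>); \<Lambda> \<le> K)\<close>, which is finite everywhere. The resulting \<open>L\<^sub>K\<close> is differentiable
  (\<open>limit_cgf_tilt_differentiable\<close>) and grows superlinearly, so that a stationary maximiser exists
  (\<open>truncated_optimal_tilt\<close>), and a lower bound follows from convergence of exponential moments near it
  (\<open>mgf_limit_lower_bound\<close>). Finally \<open>K\<close> tends to infinity: the truncated suprema decrease to the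
  untruncated one, by compactness of level sets and Fatou's lemma (\<open>truncated_rate_le\<close>). The
  hypothesis \<open>a > \<rho>(t)\<close> makes the rate positive (\<open>rate_positive_point\<close>), which keeps the maximisers away
  from zero.
\<close>

section \<open>Slot means of the exponential kernel\<close>

text \<open>The mean over the \<open>j\<close>-th slot \<open>[j \<delta>, (j+1) \<delta>)\<close> of the kernel \<open>exp (- \<mu> s)\<close> cut off
  after time \<open>t\<close>: the weight with which the rate of that slot enters the Poisson parameter. The
  minimum makes the weights of the slots beyond \<open>t\<close> vanish and shortens the slot containing \<open>t\<close>.\<close>
definition slot_mean :: "real \<Rightarrow> real \<Rightarrow> real \<Rightarrow> nat \<Rightarrow> real" where
  "slot_mean \<mu> t \<delta> j =
     (exp (- \<mu> * min (real j * \<delta>) t) - exp (- \<mu> * min ((real j + 1) * \<delta>) t)) / (\<mu> * \<delta>)"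

lemma exp_decay_increment:
  fixes \<mu> u v :: real
  shows "\<mu> * (v - u) * exp (- \<mu> * v) \<le> exp (- \<mu> * u) - exp (- \<mu> * v)"
    and "exp (- \<mu> * u) - exp (- \<mu> * v) \<le> \<mu> * (v - u) * exp (- \<mu> * u)"
proof -
  have "exp (- \<mu> * v) * (1 + \<mu> * (v - u)) \<le> exp (- \<mu> * v) * exp (\<mu> * (v - u))"
    by (intro mult_left_mono exp_ge_add_one_self) auto
  also have "\<dots> = exp (- \<mu> * u)" by (simp add: exp_add[symmetric] algebra_simps)
  finally show "\<mu> * (v - u) * exp (- \<mu> * v) \<le> exp (- \<mu> * u) - exp (- \<mu> * v)"
    by (simp add: algebra_simps)
  have "exp (- \<mu> * u) * (1 + - (\<mu> * (v - u))) \<le> exp (- \<mu> * u) * exp (- (\<mu> * (v - u)))"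
    by (intro mult_left_mono exp_ge_add_one_self) auto
  also have "\<dots> = exp (- \<mu> * v)" by (simp add: exp_add[symmetric] algebra_simps)
  finally show "exp (- \<mu> * u) - exp (- \<mu> * v) \<le> \<mu> * (v - u) * exp (- \<mu> * u)"
    by (simp add: algebra_simps)
qed

lemma slot_mean_range:
  assumes "\<mu> > 0" "t > 0" "\<delta> > 0"
  shows "0 \<le> slot_mean \<mu> t \<delta> j" "slot_mean \<mu> t \<delta> j \<le> 1"
proof -
  let ?u = "min (real j * \<delta>) t" and ?v = "min ((real j + 1) * \<delta>) t"
  have uv: "0 \<le> ?u" "?u \<le> ?v" "?v - ?u \<le> \<delta>" using assms by (auto simp: min_def algebra_simps)
  have "exp (- \<mu> * ?v) \<le> exp (- \<mu> * ?u)" using uv assms by simp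
  then show "0 \<le> slot_mean \<mu> t \<delta> j" unfolding slot_mean_def using assms by simp
  have "exp (- \<mu> * ?u) - exp (- \<mu> * ?v) \<le> \<mu> * (?v - ?u) * exp (- \<mu> * ?u)"
    by (rule exp_decay_increment(2))
  also have "\<dots> \<le> \<mu> * \<delta> * 1"
    using uv assms by (intro mult_mono) auto
  finally show "slot_mean \<mu> t \<delta> j \<le> 1"
    unfolding slot_mean_def using assms by simp
qed

lemma slot_mean_0_pos:
  assumes "\<mu> > 0" "t > 0" "\<delta> > 0"
  shows "0 < slot_mean \<mu> t \<delta> 0"
  unfolding slot_mean_def using assms by (auto simp: min_def)

lemma slot_mean_full:
  assumes "\<mu> > 0" "\<delta> > 0" "(real j + 1) * \<delta> \<le> t"
  shows "exp (- \<mu> * ((real j + 1) * \<delta>)) \<le> slot_mean \<mu> t \<delta> j"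
    and "slot_mean \<mu> t \<delta> j \<le> exp (- \<mu> * (real j * \<delta>))"
proof -
  have m: "min (real j * \<delta>) t = real j * \<delta>" "min ((real j + 1) * \<delta>) t = (real j + 1) * \<delta>"
    using assms by (auto simp: algebra_simps)
  define u v where "u = real j * \<delta>" and "v = (real j + 1) * \<delta>"
  have d: "v - u = \<delta>" by (simp add: u_def v_def algebra_simps)
  have sm: "slot_mean \<mu> t \<delta> j = (exp (- \<mu> * u) - exp (- \<mu> * v)) / (\<mu> * \<delta>)"
    unfolding slot_mean_def m u_def v_def ..
  show "exp (- \<mu> * ((real j + 1) * \<delta>)) \<le> slot_mean \<mu> t \<delta> j"
       "slot_mean \<mu> t \<delta> j \<le> exp (- \<mu> * (real j * \<delta>))"
    using exp_decay_increment(1)[of \<mu> v u] exp_decay_increment(2)[of \<mu> u v] assms(1,2)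
    unfolding d sm u_def[symmetric] v_def[symmetric]
    by (simp_all add: pos_le_divide_eq pos_divide_le_eq mult_ac)
qed

lemma last_slot:
  assumes "\<delta> > 0" "t > 0"
  shows "real (nat \<lfloor>t / \<delta>\<rfloor>) * \<delta> \<le> t" "t < (real (nat \<lfloor>t / \<delta>\<rfloor>) + 1) * \<delta>"
proof -
  have "0 \<le> \<lfloor>t / \<delta>\<rfloor>" using assms by simp
  then have r: "real (nat \<lfloor>t / \<delta>\<rfloor>) = of_int \<lfloor>t / \<delta>\<rfloor>" by simp
  have "of_int \<lfloor>t / \<delta>\<rfloor> \<le> t / \<delta>" "t / \<delta> < of_int \<lfloor>t / \<delta>\<rfloor> + 1" by linarith+
  then show "real (nat \<lfloor>t / \<delta>\<rfloor>) * \<delta> \<le> t" "t < (real (nat \<lfloor>t / \<delta>\<rfloor>) + 1) * \<delta>"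
    unfolding r using pos_le_divide_eq[OF assms(1)] pos_divide_less_eq[OF assms(1)] by blast+
qed

text \<open>The rate is constant on each slot, so only the kernel has to be integrated. The slot with index
  \<open>\<lfloor>t / \<delta>\<rfloor>\<close> is the last one that meets \<open>[0, t]\<close>; it meets it in the single point \<open>t\<close>, with weight zero,
  if \<open>t\<close> is a multiple of \<open>\<delta>\<close>.\<close>
lemma kappa_eq_sum:
  assumes "\<mu> > 0" "t > 0" "\<Delta> > 0" "N \<ge> 1"
  defines "\<delta> \<equiv> \<Delta> / real N"
  shows "real N * kappa \<mu> t \<Delta> N x = \<Delta> * (\<Sum>j\<le>nat \<lfloor>t / \<delta>\<rfloor>. slot_mean \<mu> t \<delta> j * x j)"
proof -
  define m where "m = nat \<lfloor>t / \<delta>\<rfloor>"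
  have \<delta>: "\<delta> > 0" using assms by simp
  note ls = last_slot[OF \<delta> assms(2), folded m_def]
  let ?I = "\<lambda>j. {real j * \<delta> ..< (real j + 1) * \<delta>}"
  let ?g = "\<lambda>j s. indicator (?I j \<inter> {0..t}) s * exp (- \<mu> * s)"
  have rate: "arrival_rate \<Delta> N x s = (\<Sum>j\<le>m. x j * indicator (?I j) s)" if "s \<le> t" for s
  proof -
    have "arrival_rate \<Delta> N x s = (\<Sum>j. x j * indicator (?I j) s)"
      unfolding arrival_rate_def \<delta>_def by (simp add: field_simps)
    also have "\<dots> = (\<Sum>j\<le>m. x j * indicator (?I j) s)"
    proof (rule suminf_finite)
      fix j assume "j \<notin> {..m}"
      then have "real m + 1 \<le> real j" by simp
      then have "(real m + 1) * \<delta> \<le> real j * \<delta>" using \<delta> by (intro mult_right_mono) auto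
      then show "x j * indicator (?I j) s = 0" using that ls by (simp add: indicator_def)
    qed simp
    finally show ?thesis .
  qed
  have int: "has_bochner_integral lborel (?g j) (\<delta> * slot_mean \<mu> t \<delta> j)" if "j \<le> m" for j
  proof -
    have jm: "real j * \<delta> \<le> t" using that \<delta> ls(1) by (meson mult_right_mono of_nat_mono order_trans less_imp_le)
    let ?u = "min (real j * \<delta>) t" and ?v = "min ((real j + 1) * \<delta>) t"
    have uv: "?u \<le> ?v" using \<delta> by (auto simp: min_def algebra_simps)
    have "has_bochner_integral lborel (\<lambda>s. indicator {?u..?v} s *\<^sub>R exp (- \<mu> * s))
            (- exp (- \<mu> * ?v) / \<mu> - - exp (- \<mu> * ?u) / \<mu>)"
      using assms(1)
      by (intro has_bochner_integral_FTC_Icc uv)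
         (auto intro!: derivative_eq_intros continuous_intros
            simp: has_real_derivative_iff_has_vector_derivative[symmetric])
    also have "(- exp (- \<mu> * ?v) / \<mu> - - exp (- \<mu> * ?u) / \<mu>) = \<delta> * slot_mean \<mu> t \<delta> j"
      unfolding slot_mean_def using assms(1) \<delta> by (simp add: field_simps)
    finally have *: "has_bochner_integral lborel (\<lambda>s. indicator {?u..?v} s *\<^sub>R exp (- \<mu> * s))
        (\<delta> * slot_mean \<mu> t \<delta> j)" .
    have ae: "AE s in lborel. ?g j s = indicator {?u..?v} s *\<^sub>R exp (- \<mu> * s)"
      using AE_lborel_singleton[of "(real j + 1) * \<delta>"]
    proof eventually_elim
      case (elim s)
      have "real j * \<delta> \<ge> 0" using \<delta> by simp
      then show ?case using elim jm by (auto simp: indicator_def)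
    qed
    have "has_bochner_integral lborel (?g j) (\<delta> * slot_mean \<mu> t \<delta> j)
      \<longleftrightarrow> has_bochner_integral lborel (\<lambda>s. indicator {?u..?v} s *\<^sub>R exp (- \<mu> * s)) (\<delta> * slot_mean \<mu> t \<delta> j)"
      by (rule has_bochner_integral_cong_AE[OF _ _ ae]) measurable
    with * show ?thesis by simp
  qed
  have split: "indicator {0..t} s *\<^sub>R (arrival_rate \<Delta> N x s * exp (- \<mu> * s))
      = (\<Sum>j\<le>m. x j * ?g j s)" for s
  proof (cases "s \<in> {0..t}")
    case True
    then have "indicator {0..t} s *\<^sub>R (arrival_rate \<Delta> N x s * exp (- \<mu> * s))
        = (\<Sum>j\<le>m. x j * indicator (?I j) s) * exp (- \<mu> * s)" by (simp add: rate)
    also have "\<dots> = (\<Sum>j\<le>m. x j * ?g j s)"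
      unfolding sum_distrib_right
      by (intro sum.cong refl) (use True in \<open>simp add: indicator_inter_arith\<close>)
    finally show ?thesis .
  qed (simp add: indicator_inter_arith)
  have "kappa \<mu> t \<Delta> N x = (\<integral>s. (\<Sum>j\<le>m. x j * ?g j s) \<partial>lborel)"
    unfolding kappa_def set_lebesgue_integral_def
    by (rule Bochner_Integration.integral_cong[OF refl split])
  also have "\<dots> = (\<Sum>j\<le>m. x j * (\<delta> * slot_mean \<mu> t \<delta> j))"
    using int by (intro has_bochner_integral_integral_eq has_bochner_integral_sum has_bochner_integral_mult_right) auto
  finally show ?thesis
    unfolding m_def[symmetric] using assms(3,4) by (simp add: \<delta>_def sum_distrib_left field_simps)
qed

text \<open>The sums that occur as logarithms of products over slots are Riemann sums in disguise. With an
  antiderivative \<open>A\<close> of the integrand, the integral telescopes into increments of \<open>A\<close> over the slots;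
  by the mean value theorem each of them is a slot length times the integrand at an intermediate point,
  and there the kernel differs from its slot mean by at most \<open>\<mu> \<delta>\<close>. The slot that contains \<open>t\<close> is
  shorter than the others, but as a single term it contributes only \<open>O(\<delta>)\<close>.\<close>
lemma slot_sum_tendsto_integral:
  fixes h :: "real \<Rightarrow> real"
  assumes "\<mu> > 0" "t > 0" "c \<ge> 0"
    and h: "continuous_on {0..c} h"
    and \<delta>: "\<delta> \<longlonglongrightarrow> 0" "\<And>N. N \<ge> 1 \<Longrightarrow> \<delta> N > 0"
  shows "(\<lambda>N. \<delta> N * (\<Sum>j\<le>nat \<lfloor>t / \<delta> N\<rfloor>. h (c * slot_mean \<mu> t (\<delta> N) j)))
           \<longlonglongrightarrow> integral {0..t} (\<lambda>s. h (c * exp (- \<mu> * s)))"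
proof -
  define H where "H = (\<lambda>s. h (c * exp (- \<mu> * s)))"
  have range: "c * exp (- \<mu> * s) \<in> {0..c}" if "s \<in> {0..t}" for s
    using that assms mult_left_mono[of "exp (- \<mu> * s)" 1 c] by auto
  have contH: "continuous_on {0..t} H"
    unfolding H_def using range
    by (intro continuous_on_compose2[OF h] continuous_intros) auto
  define A where "A = (\<lambda>x. integral {0..x} H)"
  have A: "(A has_real_derivative H x) (at x within {0..t})" if "x \<in> {0..t}" for x
    unfolding A_def using integral_has_real_derivative[OF contH that] .
  have contA: "continuous_on {0..t} A"
    using A by (meson DERIV_continuous continuous_on_eq_continuous_within)
  obtain Hm where Hm: "\<And>y. y \<in> {0..c} \<Longrightarrow> \<bar>h y\<bar> \<le> Hm" "Hm > 0"
  proof -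
    have "compact (h ` {0..c})" by (intro compact_continuous_image h) auto
    then have "bounded (h ` {0..c})" by (rule compact_imp_bounded)
    then obtain B where "B > 0" "\<forall>y\<in>h ` {0..c}. norm y \<le> B" using bounded_pos by blast
    then show ?thesis using that[of B] by auto
  qed
  have mvt: "\<exists>s\<in>{u..v}. A v - A u = (v - u) * H s" if "0 \<le> u" "u \<le> v" "v \<le> t" for u v
  proof (cases "u = v")
    case False
    then have "u < v" using that by simp
    have "\<exists>s. u < s \<and> s < v \<and> A v - A u = (v - u) * H s"
    proof (rule mvt_simple[OF \<open>u < v\<close>, where f = A and f' = "\<lambda>s y. y * H s", THEN bexE], goal_cases)
      case (1 x)
      have "(A has_real_derivative H x) (at x within {u..v})"
        by (rule DERIV_subset[OF A]) (use 1 that in auto)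
      then show ?case unfolding has_field_derivative_def by (simp add: mult.commute[of _ "H x"])
    qed auto
    then show ?thesis by force
  qed (use that in auto)
  have key: "\<bar>\<delta>' * (\<Sum>j\<le>nat \<lfloor>t / \<delta>'\<rfloor>. h (c * slot_mean \<mu> t \<delta>' j)) - A t\<bar> \<le> t * e + 2 * Hm * \<delta>'"
    if \<delta>': "\<delta>' > 0" "e > 0" and d: "\<And>y z. y \<in> {0..c} \<Longrightarrow> z \<in> {0..c} \<Longrightarrow> \<bar>y - z\<bar> \<le> c * (\<mu> * \<delta>') \<Longrightarrow> \<bar>h y - h z\<bar> \<le> e"
    for \<delta>' e
  proof -
    define m where "m = nat \<lfloor>t / \<delta>'\<rfloor>"
    note ls = last_slot[OF \<delta>'(1) assms(2), folded m_def]
    let ?p = "\<lambda>j. min (real j * \<delta>') t"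
    let ?T = "\<lambda>j. \<delta>' * h (c * slot_mean \<mu> t \<delta>' j) - (A (?p (Suc j)) - A (?p j))"
    have in_c: "c * slot_mean \<mu> t \<delta>' j \<in> {0..c}" for j
      using slot_mean_range[OF assms(1,2) \<delta>'(1), of j] assms(3) by (auto intro: mult_left_le)
    have full: "\<bar>?T j\<bar> \<le> \<delta>' * e" if "j < m" for j
    proof -
      have "(real j + 1) * \<delta>' \<le> real m * \<delta>'" using that \<delta>' by (intro mult_right_mono) auto
      then have jt: "(real j + 1) * \<delta>' \<le> t" using ls by simp
      have p: "?p j = real j * \<delta>'" "?p (Suc j) = (real j + 1) * \<delta>'"
        using jt \<delta>' by (auto simp: algebra_simps)
      obtain s where s: "s \<in> {real j * \<delta>'..(real j + 1) * \<delta>'}"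
        "A ((real j + 1) * \<delta>') - A (real j * \<delta>') = ((real j + 1) * \<delta>' - real j * \<delta>') * H s"
        using mvt[of "real j * \<delta>'" "(real j + 1) * \<delta>'"] \<delta>' jt by (auto simp: algebra_simps)
      have T: "?T j = \<delta>' * (h (c * slot_mean \<mu> t \<delta>' j) - h (c * exp (- \<mu> * s)))"
        unfolding p s(2) H_def by (simp add: algebra_simps)
      have sm: "exp (- \<mu> * ((real j + 1) * \<delta>')) \<le> slot_mean \<mu> t \<delta>' j" "slot_mean \<mu> t \<delta>' j \<le> exp (- \<mu> * (real j * \<delta>'))"
        using slot_mean_full[OF assms(1) \<delta>'(1) jt] by auto
      have es: "exp (- \<mu> * ((real j + 1) * \<delta>')) \<le> exp (- \<mu> * s)" "exp (- \<mu> * s) \<le> exp (- \<mu> * (real j * \<delta>'))"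
        using s(1) assms(1) by auto
      have "exp (- \<mu> * (real j * \<delta>')) - exp (- \<mu> * ((real j + 1) * \<delta>'))
          \<le> \<mu> * ((real j + 1) * \<delta>' - real j * \<delta>') * exp (- \<mu> * (real j * \<delta>'))"
        by (rule exp_decay_increment)
      also have "\<dots> \<le> \<mu> * \<delta>' * 1" using assms(1) \<delta>' by (intro mult_mono) (auto simp: algebra_simps)
      finally have "\<bar>slot_mean \<mu> t \<delta>' j - exp (- \<mu> * s)\<bar> \<le> \<mu> * \<delta>'" using sm es by linarith
      then have "\<bar>c * slot_mean \<mu> t \<delta>' j - c * exp (- \<mu> * s)\<bar> \<le> c * (\<mu> * \<delta>')"
        using assms(3) by (simp add: right_diff_distrib[symmetric] abs_mult mult_left_mono)
      moreover have "0 \<le> real j * \<delta>'" using \<delta>' by simp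
      ultimately have "\<bar>h (c * slot_mean \<mu> t \<delta>' j) - h (c * exp (- \<mu> * s))\<bar> \<le> e"
        using s(1) jt by (intro d in_c range) auto
      then show ?thesis unfolding T using \<delta>' by (simp add: abs_mult)
    qed
    have last: "\<bar>?T m\<bar> \<le> 2 * Hm * \<delta>'"
    proof -
      have p: "?p m = real m * \<delta>'" "?p (Suc m) = t" using ls by (auto simp: algebra_simps)
      obtain s where s: "s \<in> {real m * \<delta>'..t}" "A t - A (real m * \<delta>') = (t - real m * \<delta>') * H s"
        using mvt[of "real m * \<delta>'" t] ls \<delta>' by auto
      have "0 \<le> real m * \<delta>'" using \<delta>' by simp
      then have "\<bar>H s\<bar> \<le> Hm" unfolding H_def using s(1) by (intro Hm range) auto
      then have "\<bar>(t - real m * \<delta>') * H s\<bar> \<le> \<delta>' * Hm"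
        using ls \<delta>' unfolding abs_mult by (intro mult_mono) (auto simp: algebra_simps)
      moreover have "\<bar>\<delta>' * h (c * slot_mean \<mu> t \<delta>' m)\<bar> \<le> \<delta>' * Hm"
        using Hm(1)[OF in_c] \<delta>' by (simp add: abs_mult)
      ultimately have "\<bar>\<delta>' * h (c * slot_mean \<mu> t \<delta>' m) - (t - real m * \<delta>') * H s\<bar> \<le> \<delta>' * Hm + \<delta>' * Hm"
        by (intro order_trans[OF abs_triangle_ineq4] add_mono)
      then show ?thesis unfolding p s(2) by (simp add: algebra_simps)
    qed
    have tel: "(\<Sum>j\<le>m. A (?p (Suc j)) - A (?p j)) = A t"
    proof -
      have "(\<Sum>j<Suc m. A (?p (Suc j)) - A (?p j)) = A (?p (Suc m)) - A (?p 0)"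
        by (rule sum_lessThan_telescope)
      also have "?p (Suc m) = t" using ls by (auto simp: algebra_simps)
      also have "A (?p 0) = 0" using assms(2) by (simp add: A_def)
      finally show ?thesis by (simp add: lessThan_Suc_atMost)
    qed
    define T where "T = ?T"
    have "\<delta>' * (\<Sum>j\<le>m. h (c * slot_mean \<mu> t \<delta>' j)) - A t = (\<Sum>j\<le>m. T j)"
      unfolding T_def sum_subtractf[of _ "\<lambda>j. A (?p (Suc j)) - A (?p j)"] tel by (simp add: sum_distrib_left)
    moreover have "\<bar>\<Sum>j\<le>m. T j\<bar> \<le> (\<Sum>j\<le>m. \<bar>T j\<bar>)" by (rule sum_abs)
    moreover have "(\<Sum>j\<le>m. \<bar>T j\<bar>) = (\<Sum>j<m. \<bar>T j\<bar>) + \<bar>T m\<bar>"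
      unfolding lessThan_Suc_atMost[symmetric] by (rule sum.lessThan_Suc)
    moreover have "(\<Sum>j<m. \<bar>T j\<bar>) \<le> (\<Sum>j<m. \<delta>' * e)"
      unfolding T_def by (intro sum_mono full) auto
    moreover have "\<bar>T m\<bar> \<le> 2 * Hm * \<delta>'"
      unfolding T_def by (rule last)
    moreover have "(\<Sum>j<m. \<delta>' * e) \<le> t * e"
      using ls(1) \<delta>' by (simp add: mult.assoc[symmetric] mult_right_mono)
    ultimately show ?thesis unfolding m_def by linarith
  qed
  have "(\<lambda>N. \<delta> N * (\<Sum>j\<le>nat \<lfloor>t / \<delta> N\<rfloor>. h (c * slot_mean \<mu> t (\<delta> N) j))) \<longlonglongrightarrow> A t"
  proof (rule tendstoI)
    fix \<epsilon> :: real assume "\<epsilon> > 0"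
    define e where "e = \<epsilon> / (4 * t)"
    have e: "e > 0" "t * e = \<epsilon> / 4" using \<open>\<epsilon> > 0\<close> assms(2) by (auto simp: e_def)
    have "uniformly_continuous_on {0..c} h" by (intro compact_uniformly_continuous h) auto
    then obtain d where d: "d > 0" "\<And>y z. y \<in> {0..c} \<Longrightarrow> z \<in> {0..c} \<Longrightarrow> \<bar>y - z\<bar> < d \<Longrightarrow> \<bar>h y - h z\<bar> < e"
      using e(1) unfolding uniformly_continuous_on_def dist_real_def by metis
    have lim: "(\<lambda>N. c * (\<mu> * \<delta> N)) \<longlonglongrightarrow> c * (\<mu> * 0)" "(\<lambda>N. 2 * Hm * \<delta> N) \<longlonglongrightarrow> 2 * Hm * 0"
      by (intro tendsto_intros \<delta>(1))+
    have "eventually (\<lambda>N. c * (\<mu> * \<delta> N) < d) sequentially"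
      "eventually (\<lambda>N. 2 * Hm * \<delta> N < \<epsilon> / 4) sequentially"
      by (rule order_tendstoD(2)[OF lim(1)], use d(1) in simp)
         (rule order_tendstoD(2)[OF lim(2)], use \<open>\<epsilon> > 0\<close> in simp)
    then show "\<forall>\<^sub>F N in sequentially. dist (\<delta> N * (\<Sum>j\<le>nat \<lfloor>t / \<delta> N\<rfloor>. h (c * slot_mean \<mu> t (\<delta> N) j))) (A t) < \<epsilon>"
      using eventually_ge_at_top[of 1]
    proof eventually_elim
      case (elim N)
      have "\<bar>\<delta> N * (\<Sum>j\<le>nat \<lfloor>t / \<delta> N\<rfloor>. h (c * slot_mean \<mu> t (\<delta> N) j)) - A t\<bar> \<le> t * e + 2 * Hm * \<delta> N"
        using elim e d \<delta>(2) by (intro key) (auto intro!: less_imp_le)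
      then show ?case using elim e(2) \<open>\<epsilon> > 0\<close> unfolding dist_real_def by linarith
    qed
  qed
  then show ?thesis unfolding A_def H_def .
qed

section \<open>Restricted moment generating functions\<close>

text \<open>The set \<open>B\<close> is either everything or a half-line \<open>{..K}\<close>. Restricting to a half-line makes the
  transform finite at every argument, at the price of total mass below one; as a function of the argument it
  is then smooth enough for exponential tilting, whatever the tail of the law.\<close>
definition restricted_mgf :: "real measure \<Rightarrow> real set \<Rightarrow> real \<Rightarrow> ennreal" where
  "restricted_mgf D B y = (\<integral>\<^sup>+x. ennreal (exp (y * x)) * indicator B x \<partial>D)"

definition restricted_cgf :: "real measure \<Rightarrow> real set \<Rightarrow> real \<Rightarrow> real" where
  "restricted_cgf D B y = ln (enn2real (restricted_mgf D B y))"

locale positive_law = prob_space D for D :: "real measure" +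
  assumes sets_D [measurable_cong]: "sets D = sets borel"
    and positive: "AE x in D. 0 < x"
begin

lemma restricted_mgf_mono:
  assumes "y \<le> y'" "B \<subseteq> B'"
  shows "restricted_mgf D B y \<le> restricted_mgf D B' y'"
  unfolding restricted_mgf_def
  using positive
  by (intro nn_integral_mono_AE, eventually_elim)
     (use assms in \<open>auto simp: indicator_def intro!: ennreal_leI mult_right_mono\<close>)

lemma restricted_mgf_0:
  assumes "B \<in> sets borel"
  shows "restricted_mgf D B 0 = emeasure D B"
  unfolding restricted_mgf_def using assms by (simp add: sets_D)

lemma restricted_mgf_pos:
  assumes "B \<in> sets borel" "emeasure D B > 0" "y \<ge> 0"
  shows "restricted_mgf D B y > 0"
  using restricted_mgf_mono[of 0 y B B] restricted_mgf_0[OF assms(1)] assms(2,3) by simp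

lemma restricted_mgf_atMost_finite:
  assumes "y \<ge> 0"
  shows "restricted_mgf D {..K} y < \<infinity>"
proof -
  have "restricted_mgf D {..K} y \<le> (\<integral>\<^sup>+x. ennreal (exp (y * K)) \<partial>D)"
    unfolding restricted_mgf_def
    by (intro nn_integral_mono) (use assms in \<open>auto simp: indicator_def intro!: ennreal_leI mult_left_mono\<close>)
  also have "\<dots> = ennreal (exp (y * K))" by (simp add: emeasure_space_1)
  finally show ?thesis by (auto simp: top_unique intro: le_less_trans)
qed

lemma restricted_mgf_finite_le:
  assumes "restricted_mgf D B C < \<infinity>" "y \<le> C"
  shows "restricted_mgf D B y < \<infinity>"
  using restricted_mgf_mono[OF assms(2) order_refl, of B] assms(1) by (rule le_less_trans)

lemma continuous_restricted_mgf:
  assumes [measurable]: "B \<in> sets borel" and fin: "restricted_mgf D B C < \<infinity>"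
  shows "continuous_on {0..C} (\<lambda>y. enn2real (restricted_mgf D B y))"
  unfolding continuous_on_sequentially comp_def
proof safe
  fix Y :: "nat \<Rightarrow> real" and y assume y: "y \<in> {0..C}" "\<forall>n. Y n \<in> {0..C}" "Y \<longlonglongrightarrow> y"
  have lim: "(\<lambda>n. restricted_mgf D B (Y n)) \<longlonglongrightarrow> restricted_mgf D B y"
    unfolding restricted_mgf_def
  proof (rule nn_integral_dominated_convergence)
    show "(\<integral>\<^sup>+x. ennreal (exp (C * x)) * indicator B x \<partial>D) < \<infinity>"
      using fin unfolding restricted_mgf_def .
    show "AE x in D. ennreal (exp (Y j * x)) * indicator B x \<le> ennreal (exp (C * x)) * indicator B x" for j
      using positive by eventually_elim
        (use y in \<open>auto simp: indicator_def intro!: ennreal_leI mult_right_mono\<close>)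
    show "AE x in D. (\<lambda>i. ennreal (exp (Y i * x)) * indicator B x) \<longlonglongrightarrow> ennreal (exp (y * x)) * indicator B x"
      by (rule AE_I2) (use y(3) in \<open>auto simp: indicator_def intro!: tendsto_intros\<close>)
  qed measurable
  have "restricted_mgf D B y < \<infinity>" using restricted_mgf_finite_le[OF fin, of y] y(1) by auto
  then have "ennreal (enn2real (restricted_mgf D B y)) = restricted_mgf D B y" by simp
  then show "(\<lambda>n. enn2real (restricted_mgf D B (Y n))) \<longlonglongrightarrow> enn2real (restricted_mgf D B y)"
    using lim by (intro tendsto_enn2real) auto
qed

lemma enn2real_restricted_mgf_pos:
  assumes "B \<in> sets borel" "emeasure D B > 0" "restricted_mgf D B y < \<infinity>" "y \<ge> 0"
  shows "enn2real (restricted_mgf D B y) > 0"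
  using restricted_mgf_pos[OF assms(1,2,4)] assms(3) by (simp add: enn2real_positive_iff)

lemma continuous_restricted_cgf:
  assumes "B \<in> sets borel" "emeasure D B > 0" "restricted_mgf D B C < \<infinity>"
  shows "continuous_on {0..C} (restricted_cgf D B)"
  unfolding restricted_cgf_def[abs_def]
proof (intro continuous_on_ln continuous_restricted_mgf assms ballI)
  fix y assume "y \<in> {0..C}"
  then show "enn2real (restricted_mgf D B y) \<noteq> 0"
    using enn2real_restricted_mgf_pos[OF assms(1,2) restricted_mgf_finite_le[OF assms(3)], of y] by auto
qed

lemma restricted_mgf_atMost_tendsto:
  "(\<lambda>K. restricted_mgf D {..real K} y) \<longlonglongrightarrow> restricted_mgf D UNIV y"
  unfolding restricted_mgf_def
proof (rule nn_integral_LIMSEQ)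
  show "incseq (\<lambda>K x. ennreal (exp (y * x)) * indicator {..real K} x)"
    by (auto simp: incseq_def le_fun_def indicator_def)
  show "(\<lambda>K. ennreal (exp (y * x)) * indicator {..real K} x) \<longlonglongrightarrow> ennreal (exp (y * x)) * indicator UNIV x" for x
  proof (rule tendsto_eventually)
    obtain K0 where "x \<le> real K0" using real_arch_simple by blast
    then have "indicator {..real K} x = (1::ennreal)" if "K \<ge> K0" for K using that by (auto simp: indicator_def)
    then show "\<forall>\<^sub>F K in sequentially. ennreal (exp (y * x)) * indicator {..real K} x = ennreal (exp (y * x)) * indicator UNIV x"
      unfolding eventually_sequentially by (intro exI[of _ K0]) simp
  qed
qed measurable

end

section \<open>Exponential moments of the mixed Poisson queue\<close>

text \<open>Conditioning on the rates turns the exponential moment of the queue into that of a Poisson variable,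
  also on an event \<open>A\<close> that is determined by the rates. The conditional law is known only for one value
  \<open>k\<close> at a time, so both sides are expanded into series over \<open>k\<close>.\<close>
lemma (in prob_space) cond_poisson_mgf:
  assumes X: "\<And>j. X j \<in> borel_measurable M"
    and Q: "cond_poisson M X R Q"
    and R [measurable]: "R \<in> borel_measurable M" and R_pos: "AE \<omega> in M. 0 < R \<omega>"
    and A: "A \<in> sets (sigma_generated M X)"
  shows "(\<integral>\<^sup>+\<omega>. ennreal (exp (\<eta> * real (Q \<omega>))) * indicator A \<omega> \<partial>M)
       = (\<integral>\<^sup>+\<omega>. ennreal (exp ((exp \<eta> - 1) * R \<omega>)) * indicator A \<omega> \<partial>M)"
proof -
  define F where "F = sigma_generated M X"
  have "subalgebra M F"
    unfolding subalgebra_def F_def sigma_generated_def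
  proof (intro conjI)
    have "(\<lambda>\<omega> j. X j \<omega>) \<in> measurable M (\<Pi>\<^sub>M j\<in>UNIV. borel)"
      by (rule measurable_PiM_single') (use X in \<open>auto\<close>)
    then show "sets (vimage_algebra (space M) (\<lambda>\<omega> j. X j \<omega>) (\<Pi>\<^sub>M j\<in>UNIV. borel)) \<subseteq> sets M"
      unfolding sets_vimage_algebra by (intro sets.sigma_sets_subset) (auto intro: measurable_sets)
  qed simp
  then interpret finite_measure_subalgebra M F by unfold_locales
  have Q_meas [measurable]: "Q \<in> measurable M (count_space UNIV)" using Q by (simp add: cond_poisson_def)
  have AM [measurable]: "A \<in> sets M" using A subalg unfolding F_def[symmetric] by (auto simp: subalgebra_def)
  define pr where "pr = (\<lambda>k r::real. r ^ k / fact k * exp (- r))"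
  have prob_k: "emeasure M ({\<omega> \<in> space M. Q \<omega> = k} \<inter> A) = (\<integral>\<^sup>+\<omega>. ennreal (pr k (R \<omega>)) * indicator A \<omega> \<partial>M)" for k
  proof -
    let ?f = "indicator {\<omega> \<in> space M. Q \<omega> = k} :: 'a \<Rightarrow> real"
    let ?g = "real_cond_exp M F ?f"
    have ae: "AE \<omega> in M. ?g \<omega> = pr k (R \<omega>)"
    proof -
      have "AE \<omega> in M. ?g \<omega> = pmf (poisson_pmf (R \<omega>)) k"
        using Q unfolding cond_poisson_def F_def[symmetric] by blast
      with R_pos show ?thesis by eventually_elim (simp add: pr_def)
    qed
    have intf: "integrable M ?f"
      by (rule integrable_real_indicator) (measurable, simp add: less_top[symmetric])
    have gint: "integrable M (\<lambda>\<omega>. indicator A \<omega> *\<^sub>R ?g \<omega>)"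
      by (intro integrable_mult_indicator real_cond_exp_int(1) intf AM)
    have nn: "AE \<omega> in M. 0 \<le> indicator A \<omega> *\<^sub>R ?g \<omega>"
      using ae R_pos by eventually_elim (auto simp: pr_def indicator_def)
    have "measure M ({\<omega> \<in> space M. Q \<omega> = k} \<inter> A) = (\<integral>\<omega>\<in>A. ?f \<omega> \<partial>M)"
      unfolding set_lebesgue_integral_def by (simp add: indicator_inter_arith[symmetric] Int_commute)
    also have "\<dots> = (\<integral>\<omega>\<in>A. ?g \<omega> \<partial>M)"
      by (rule real_cond_exp_intA[OF intf]) (use A in \<open>simp add: F_def\<close>)
    also have "ennreal \<dots> = (\<integral>\<^sup>+\<omega>. ennreal (indicator A \<omega> *\<^sub>R ?g \<omega>) \<partial>M)"
      unfolding set_lebesgue_integral_def by (rule nn_integral_eq_integral[symmetric, OF gint nn])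
    also have "\<dots> = (\<integral>\<^sup>+\<omega>. ennreal (pr k (R \<omega>)) * indicator A \<omega> \<partial>M)"
      by (rule nn_integral_cong_AE) (use ae in \<open>eventually_elim, auto simp: indicator_def\<close>)
    finally show ?thesis by (simp add: emeasure_eq_measure)
  qed
  have "(\<integral>\<^sup>+\<omega>. ennreal (exp (\<eta> * real (Q \<omega>))) * indicator A \<omega> \<partial>M)
      = (\<integral>\<^sup>+\<omega>. (\<Sum>k. ennreal (exp (\<eta> * real k)) * indicator ({\<omega> \<in> space M. Q \<omega> = k} \<inter> A) \<omega>) \<partial>M)"
  proof (rule nn_integral_cong)
    fix \<omega> assume "\<omega> \<in> space M"
    have "(\<Sum>k. ennreal (exp (\<eta> * real k)) * indicator ({\<omega> \<in> space M. Q \<omega> = k} \<inter> A) \<omega>)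
       = (\<Sum>k\<in>{Q \<omega>}. ennreal (exp (\<eta> * real k)) * indicator ({\<omega> \<in> space M. Q \<omega> = k} \<inter> A) \<omega>)"
      by (rule suminf_finite) auto
    also have "\<dots> = ennreal (exp (\<eta> * real (Q \<omega>))) * indicator A \<omega>"
      using \<open>\<omega> \<in> space M\<close> by (simp add: indicator_def)
    finally show "ennreal (exp (\<eta> * real (Q \<omega>))) * indicator A \<omega>
      = (\<Sum>k. ennreal (exp (\<eta> * real k)) * indicator ({\<omega> \<in> space M. Q \<omega> = k} \<inter> A) \<omega>)" ..
  qed
  also have "\<dots> = (\<Sum>k. ennreal (exp (\<eta> * real k)) * emeasure M ({\<omega> \<in> space M. Q \<omega> = k} \<inter> A))"
    by (subst nn_integral_suminf) (auto simp: nn_integral_cmult_indicator)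
  also have "\<dots> = (\<Sum>k. \<integral>\<^sup>+\<omega>. ennreal (exp (\<eta> * real k)) * (ennreal (pr k (R \<omega>)) * indicator A \<omega>) \<partial>M)"
    unfolding prob_k by (subst nn_integral_cmult) (auto simp: pr_def)
  also have "\<dots> = (\<integral>\<^sup>+\<omega>. (\<Sum>k. ennreal (exp (\<eta> * real k)) * (ennreal (pr k (R \<omega>)) * indicator A \<omega>)) \<partial>M)"
    by (subst nn_integral_suminf) (auto simp: pr_def)
  also have "\<dots> = (\<integral>\<^sup>+\<omega>. ennreal (exp ((exp \<eta> - 1) * R \<omega>)) * indicator A \<omega> \<partial>M)"
  proof (rule nn_integral_cong_AE, use R_pos in eventually_elim)
    case (elim \<omega>)
    let ?r = "R \<omega>"
    have "(\<lambda>k. exp (- ?r) * ((exp \<eta> * ?r) ^ k /\<^sub>R fact k)) sums (exp (- ?r) * exp (exp \<eta> * ?r))"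
      by (intro sums_mult exp_converges)
    also have "(\<lambda>k. exp (- ?r) * ((exp \<eta> * ?r) ^ k /\<^sub>R fact k)) = (\<lambda>k. exp (\<eta> * real k) * pr k ?r)"
      by (auto simp: pr_def power_mult_distrib exp_of_nat2_mult[symmetric] field_simps)
    also have "exp (- ?r) * exp (exp \<eta> * ?r) = exp ((exp \<eta> - 1) * ?r)"
      by (simp add: exp_add[symmetric] algebra_simps)
    finally have "(\<Sum>k. ennreal (exp (\<eta> * real k) * pr k ?r)) = ennreal (exp ((exp \<eta> - 1) * ?r))"
      using elim by (intro suminf_ennreal_eq) (auto simp: pr_def)
    moreover have "ennreal (exp (\<eta> * real k)) * ennreal (pr k ?r) = ennreal (exp (\<eta> * real k) * pr k ?r)" for k
      by (simp add: ennreal_mult')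
    ultimately show ?case by (cases "\<omega> \<in> A") simp_all
  qed
  finally show ?thesis .
qed

text \<open>Independence of the rates factorises the exponential moment of the Poisson parameter over the
  slots. The positivity of the first weight and of the rates ensures a positive Poisson parameter, as
  required by the conditional law.\<close>
lemma (in prob_space) queue_restricted_mgf:
  assumes D: "positive_law D"
    and indep: "indep_vars (\<lambda>_. borel) X UNIV"
    and law: "\<And>j. distr M borel (X j) = D"
    and Q: "cond_poisson M X (\<lambda>\<omega>. real N * kappa \<mu> t \<Delta> N (\<lambda>j. X j \<omega>)) Q"
    and pos: "\<mu> > 0" "t > 0" "\<Delta> > 0" "N \<ge> 1"
    and [measurable]: "B \<in> sets borel"
  defines "\<delta> \<equiv> \<Delta> / real N"
  shows "(\<integral>\<^sup>+\<omega>. ennreal (exp (\<eta> * real (Q \<omega>))) * indicator {\<omega> \<in> space M. \<forall>j\<le>nat \<lfloor>t / \<delta>\<rfloor>. X j \<omega> \<in> B} \<omega> \<partial>M)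
       = (\<Prod>j\<le>nat \<lfloor>t / \<delta>\<rfloor>. restricted_mgf D B (\<Delta> * (exp \<eta> - 1) * slot_mean \<mu> t \<delta> j))"
proof -
  interpret D: positive_law D by (rule D)
  define m where "m = nat \<lfloor>t / \<delta>\<rfloor>"
  define w where "w = slot_mean \<mu> t \<delta>"
  define R where "R = (\<lambda>\<omega>. \<Delta> * (\<Sum>j\<le>m. w j * X j \<omega>))"
  have \<delta>: "\<delta> > 0" using pos by (simp add: \<delta>_def)
  have X [measurable]: "X j \<in> borel_measurable M" for j
    using indep unfolding indep_vars_def by auto
  have R_eq: "(\<lambda>\<omega>. real N * kappa \<mu> t \<Delta> N (\<lambda>j. X j \<omega>)) = R"
    unfolding R_def m_def w_def \<delta>_def using kappa_eq_sum[OF pos(1,2,3,4)] by blast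
  have X_pos: "AE \<omega> in M. \<forall>j. 0 < X j \<omega>"
    unfolding AE_all_countable
  proof
    fix j
    have "AE x in distr M borel (X j). 0 < x" unfolding law by (rule D.positive)
    then show "AE \<omega> in M. 0 < X j \<omega>" using AE_distr_iff[OF X, of "\<lambda>x. 0 < x" j] by simp
  qed
  have R_pos: "AE \<omega> in M. 0 < R \<omega>"
    using X_pos
  proof eventually_elim
    case (elim \<omega>)
    have "0 < w 0 * X 0 \<omega>" using slot_mean_0_pos[OF pos(1,2) \<delta>] elim by (simp add: w_def)
    also have "\<dots> \<le> (\<Sum>j\<le>m. w j * X j \<omega>)"
      using elim slot_mean_range(1)[OF pos(1,2) \<delta>] 
      by (intro member_le_sum) (auto simp: w_def less_imp_le)
    finally show ?case unfolding R_def using pos by simp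
  qed
  have XF: "X j \<in> borel_measurable (sigma_generated M X)" for j
  proof -
    have "(\<lambda>\<omega> j. X j \<omega>) \<in> measurable (sigma_generated M X) (\<Pi>\<^sub>M j\<in>UNIV. borel)"
      unfolding sigma_generated_def by (rule measurable_vimage_algebra1) (auto simp: space_PiM)
    from measurable_compose[OF this measurable_component_singleton[of j]] show ?thesis by simp
  qed
  have spF: "space (sigma_generated M X) = space M" by (simp add: sigma_generated_def)
  have A: "{\<omega> \<in> space M. \<forall>j\<le>m. X j \<omega> \<in> B} \<in> sets (sigma_generated M X)"
    unfolding spF[symmetric] using XF by measurable
  have "(\<integral>\<^sup>+\<omega>. ennreal (exp (\<eta> * real (Q \<omega>))) * indicator {\<omega> \<in> space M. \<forall>j\<le>m. X j \<omega> \<in> B} \<omega> \<partial>M)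
     = (\<integral>\<^sup>+\<omega>. ennreal (exp ((exp \<eta> - 1) * R \<omega>)) * indicator {\<omega> \<in> space M. \<forall>j\<le>m. X j \<omega> \<in> B} \<omega> \<partial>M)"
    by (rule cond_poisson_mgf[OF X _ _ R_pos A]) (use Q in \<open>simp_all add: R_eq R_def\<close>)
  also have "\<dots> = (\<integral>\<^sup>+\<omega>. (\<Prod>j\<le>m. ennreal (exp (\<Delta> * (exp \<eta> - 1) * w j * X j \<omega>)) * indicator B (X j \<omega>)) \<partial>M)"
  proof (rule nn_integral_cong)
    fix \<omega> assume "\<omega> \<in> space M"
    then have "indicator {\<omega> \<in> space M. \<forall>j\<le>m. X j \<omega> \<in> B} \<omega> = (\<Prod>j\<le>m. indicator B (X j \<omega>) :: ennreal)"
      by (auto simp: indicator_def)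
    moreover have "ennreal (exp ((exp \<eta> - 1) * R \<omega>)) = (\<Prod>j\<le>m. ennreal (exp (\<Delta> * (exp \<eta> - 1) * w j * X j \<omega>)))"
      by (simp add: prod_ennreal exp_sum[symmetric] R_def sum_distrib_left mult_ac)
    ultimately show "ennreal (exp ((exp \<eta> - 1) * R \<omega>)) * indicator {\<omega> \<in> space M. \<forall>j\<le>m. X j \<omega> \<in> B} \<omega>
       = (\<Prod>j\<le>m. ennreal (exp (\<Delta> * (exp \<eta> - 1) * w j * X j \<omega>)) * indicator B (X j \<omega>))"
      by (simp add: prod.distrib)
  qed
  also have "\<dots> = (\<Prod>j\<le>m. \<integral>\<^sup>+\<omega>. ennreal (exp (\<Delta> * (exp \<eta> - 1) * w j * X j \<omega>)) * indicator B (X j \<omega>) \<partial>M)"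
    by (intro indep_vars_nn_integral indep_vars_compose2[where Y = "\<lambda>j x. ennreal (exp (\<Delta> * (exp \<eta> - 1) * w j * x)) * indicator B x", OF indep_vars_subset[OF indep]]) auto
  also have "\<dots> = (\<Prod>j\<le>m. restricted_mgf D B (\<Delta> * (exp \<eta> - 1) * w j))"
    unfolding restricted_mgf_def
    by (intro prod.cong refl, subst law[symmetric], subst nn_integral_distr) auto
  finally show ?thesis unfolding m_def w_def .
qed

text \<open>The argument at which the transform of a rate has to be taken: a Poisson variable with parameter
  \<open>r\<close> has moment generating function \<open>exp (r (exp \<eta> - 1))\<close>, here with \<open>\<eta> = \<theta> / \<Delta>\<close> and \<open>r\<close> of
  order \<open>\<Delta>\<close> times a rate.\<close>
definition tilt :: "real \<Rightarrow> real \<Rightarrow> real" where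
  "tilt \<Delta> \<theta> = \<Delta> * (exp (\<theta> / \<Delta>) - 1)"

definition limit_cgf :: "real measure \<Rightarrow> real set \<Rightarrow> real \<Rightarrow> real \<Rightarrow> real \<Rightarrow> real" where
  "limit_cgf D B \<mu> t c = integral {0..t} (\<lambda>s. restricted_cgf D B (c * exp (- \<mu> * s)))"

section \<open>A large-deviation lower bound from exponential moments\<close>

text \<open>The lower half of the Gaertner-Ellis theorem at a point where the limiting cumulant function
  \<open>G\<close> is differentiable, without a change of measure. Cut the exponential moment at \<open>\<theta>\<close> according to
  whether \<open>X\<close> lies above \<open>a + \<epsilon>\<close>, below \<open>a - \<epsilon>\<close> or in between. The outer parts are bounded by the moments
  at \<open>\<theta> + h\<close> and \<open>\<theta> - h\<close>, which for small \<open>h\<close> are exponentially smaller because \<open>a\<close> is the derivative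
  of \<open>G\<close> at \<open>\<theta>\<close>. Hence the middle part carries the moment, and there the exponential is at most
  \<open>exp (v \<theta> (a + \<epsilon>))\<close>. The events \<open>A\<close> allow \<open>G\<close> to belong to a truncated model.\<close>
lemma (in prob_space) mgf_limit_lower_bound:
  fixes X :: "nat \<Rightarrow> 'a \<Rightarrow> real" and A :: "nat \<Rightarrow> 'a set" and v :: "nat \<Rightarrow> real" and G :: "real \<Rightarrow> real"
  defines "E \<equiv> \<lambda>N \<eta>. \<integral>\<^sup>+\<omega>. ennreal (exp (\<eta> * v N * X N \<omega>)) * indicator (A N) \<omega> \<partial>M"
  assumes [measurable]: "\<And>N. X N \<in> borel_measurable M" "\<And>N. A N \<in> sets M"
    and v: "filterlim v at_top sequentially"
    and fin: "\<And>\<eta>. \<eta> > 0 \<Longrightarrow> eventually (\<lambda>N. 0 < E N \<eta> \<and> E N \<eta> < \<infinity>) sequentially"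
    and G: "\<And>\<eta>. \<eta> > 0 \<Longrightarrow> (\<lambda>N. ln (enn2real (E N \<eta>)) / v N) \<longlonglongrightarrow> G \<eta>"
    and "\<theta> > 0" and deriv: "(G has_real_derivative a) (at \<theta>)"
    and "\<epsilon> > 0" "\<tau> > 0"
  shows "eventually (\<lambda>N. exp (v N * (G \<theta> - \<theta> * (a + \<epsilon>) - \<tau>)) \<le> prob {\<omega> \<in> space M. X N \<omega> > a - \<epsilon>}) sequentially"
proof -
  obtain d where d: "d > 0" "\<And>k. k \<noteq> 0 \<Longrightarrow> \<bar>k\<bar> < d \<Longrightarrow> \<bar>(G (\<theta> + k) - G \<theta>) / k - a\<bar> < \<epsilon> / 2"
    using LIM_D[OF deriv[unfolded DERIV_def], of "\<epsilon> / 2"] \<open>\<epsilon> > 0\<close> by (auto simp: real_norm_def)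
  define h where "h = min d \<theta> / 2"
  have h: "0 < h" "h < d" "h < \<theta>" using d \<open>\<theta> > 0\<close> by (auto simp: h_def)
  have Gp: "G (\<theta> + h) - h * (a + \<epsilon>) \<le> G \<theta> - h * \<epsilon> / 2"
  proof -
    have "(G (\<theta> + h) - G \<theta>) / h < a + \<epsilon> / 2" using d(2)[of h] h by linarith
    then show ?thesis using h(1) by (simp add: pos_divide_less_eq algebra_simps)
  qed
  have Gm: "G (\<theta> - h) + h * (a - \<epsilon>) \<le> G \<theta> - h * \<epsilon> / 2"
  proof -
    have "a - \<epsilon> / 2 < (G (\<theta> + - h) - G \<theta>) / - h" using d(2)[of "- h"] h by linarith
    also have "\<dots> = (G \<theta> - G (\<theta> - h)) / h" using h(1) by (simp add: field_simps)
    finally have "(a - \<epsilon> / 2) * h < G \<theta> - G (\<theta> - h)" using pos_less_divide_eq[OF h(1)] by blast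
    then show ?thesis by (simp add: algebra_simps)
  qed
  \<comment> \<open>an error in the exponents that eats up neither the gap \<open>h \<epsilon> / 2\<close> nor the allowance \<open>\<tau>\<close>\<close>
  define \<sigma> where "\<sigma> = min (h * \<epsilon> / 8) (\<tau> / 2)"
  have \<sigma>: "0 < \<sigma>" "\<sigma> \<le> h * \<epsilon> / 8" "\<sigma> \<le> \<tau> / 2" using h \<open>\<epsilon> > 0\<close> \<open>\<tau> > 0\<close> by (auto simp: \<sigma>_def)
  have bounds: "eventually (\<lambda>N. exp (v N * (G \<eta> - \<sigma>)) \<le> enn2real (E N \<eta>)
      \<and> enn2real (E N \<eta>) \<le> exp (v N * (G \<eta> + \<sigma>)) \<and> ennreal (enn2real (E N \<eta>)) = E N \<eta>) sequentially"
    if "\<eta> > 0" for \<eta>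
    using tendstoD[OF G[OF that] \<sigma>(1)] fin[OF that] filterlim_at_top_dense[THEN iffD1, OF v, rule_format, of 0]
  proof eventually_elim
    case (elim N)
    have pos: "enn2real (E N \<eta>) > 0" using elim(2) by (simp add: enn2real_positive_iff)
    have "\<bar>ln (enn2real (E N \<eta>)) / v N - G \<eta>\<bar> < \<sigma>" using elim by (simp add: dist_real_def)
    then have "v N * (G \<eta> - \<sigma>) \<le> ln (enn2real (E N \<eta>))" "ln (enn2real (E N \<eta>)) \<le> v N * (G \<eta> + \<sigma>)"
      using elim(3) by (auto simp: abs_less_iff field_simps)
    then have "exp (v N * (G \<eta> - \<sigma>)) \<le> exp (ln (enn2real (E N \<eta>)))"
      "exp (ln (enn2real (E N \<eta>))) \<le> exp (v N * (G \<eta> + \<sigma>))" by auto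
    then show ?case using pos elim(2) by simp
  qed
  have split: "E N \<theta> \<le> ennreal (exp (v N * (\<theta> * (a + \<epsilon>)))) * emeasure M {\<omega> \<in> space M. X N \<omega> > a - \<epsilon>}
     + ennreal (exp (- v N * (h * (a + \<epsilon>)))) * E N (\<theta> + h) + ennreal (exp (v N * (h * (a - \<epsilon>)))) * E N (\<theta> - h)"
    if vN: "v N > 0" for N
  proof -
    let ?S = "{\<omega> \<in> space M. X N \<omega> > a - \<epsilon>}"
    have "E N \<theta> \<le> (\<integral>\<^sup>+\<omega>. (ennreal (exp (v N * (\<theta> * (a + \<epsilon>)))) * indicator ?S \<omega>
      + ennreal (exp (- v N * (h * (a + \<epsilon>)))) * (ennreal (exp ((\<theta> + h) * v N * X N \<omega>)) * indicator (A N) \<omega>))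
      + ennreal (exp (v N * (h * (a - \<epsilon>)))) * (ennreal (exp ((\<theta> - h) * v N * X N \<omega>)) * indicator (A N) \<omega>) \<partial>M)"
      unfolding E_def
    proof (rule nn_integral_mono)
      fix \<omega> assume w: "\<omega> \<in> space M"
      let ?x = "X N \<omega>"
      consider "?x \<ge> a + \<epsilon>" | "?x \<le> a - \<epsilon>" | "a - \<epsilon> < ?x" "?x < a + \<epsilon>" by linarith
      then show "ennreal (exp (\<theta> * v N * ?x)) * indicator (A N) \<omega> \<le>
         (ennreal (exp (v N * (\<theta> * (a + \<epsilon>)))) * indicator ?S \<omega>
      + ennreal (exp (- v N * (h * (a + \<epsilon>)))) * (ennreal (exp ((\<theta> + h) * v N * ?x)) * indicator (A N) \<omega>))
      + ennreal (exp (v N * (h * (a - \<epsilon>)))) * (ennreal (exp ((\<theta> - h) * v N * ?x)) * indicator (A N) \<omega>)"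
      proof cases
        case 1
        have "0 \<le> (v N * h) * (?x - (a + \<epsilon>))" using 1 vN h by simp
        then have "\<theta> * v N * ?x \<le> - v N * (h * (a + \<epsilon>)) + (\<theta> + h) * v N * ?x" by (simp add: algebra_simps)
        then have "ennreal (exp (\<theta> * v N * ?x)) \<le> ennreal (exp (- v N * (h * (a + \<epsilon>)))) * ennreal (exp ((\<theta> + h) * v N * ?x))"
          by (simp add: ennreal_mult[symmetric] exp_add[symmetric])
        then have "ennreal (exp (\<theta> * v N * ?x)) * indicator (A N) \<omega>
          \<le> ennreal (exp (- v N * (h * (a + \<epsilon>)))) * (ennreal (exp ((\<theta> + h) * v N * ?x)) * indicator (A N) \<omega>)"
          by (simp add: indicator_def)
        then show ?thesis by (meson add_increasing add_increasing2 zero_le)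
      next
        case 2
        have "0 \<le> (v N * h) * ((a - \<epsilon>) - ?x)" using 2 vN h by simp
        then have "\<theta> * v N * ?x \<le> v N * (h * (a - \<epsilon>)) + (\<theta> - h) * v N * ?x" by (simp add: algebra_simps)
        then have "ennreal (exp (\<theta> * v N * ?x)) \<le> ennreal (exp (v N * (h * (a - \<epsilon>)))) * ennreal (exp ((\<theta> - h) * v N * ?x))"
          by (simp add: ennreal_mult[symmetric] exp_add[symmetric])
        then have "ennreal (exp (\<theta> * v N * ?x)) * indicator (A N) \<omega>
          \<le> ennreal (exp (v N * (h * (a - \<epsilon>)))) * (ennreal (exp ((\<theta> - h) * v N * ?x)) * indicator (A N) \<omega>)"
          by (simp add: indicator_def)
        then show ?thesis by (meson add_increasing zero_le)
      next
        case 3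
        have "(v N * \<theta>) * ?x \<le> (v N * \<theta>) * (a + \<epsilon>)" using 3 vN \<open>\<theta> > 0\<close> by (intro mult_left_mono) auto
        then have "\<theta> * v N * ?x \<le> v N * (\<theta> * (a + \<epsilon>))" by (simp add: mult_ac)
        then have "ennreal (exp (\<theta> * v N * ?x)) * indicator (A N) \<omega> \<le> ennreal (exp (v N * (\<theta> * (a + \<epsilon>)))) * indicator ?S \<omega>"
          using 3 w by (simp add: indicator_def)
        then show ?thesis by (meson add_increasing2 zero_le)
      qed
    qed
    also have "\<dots> = ennreal (exp (v N * (\<theta> * (a + \<epsilon>)))) * emeasure M ?S
     + ennreal (exp (- v N * (h * (a + \<epsilon>)))) * E N (\<theta> + h) + ennreal (exp (v N * (h * (a - \<epsilon>)))) * E N (\<theta> - h)"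
      unfolding E_def by (simp add: nn_integral_add nn_integral_cmult)
    finally show ?thesis .
  qed
  have big: "eventually (\<lambda>N. v N > b) sequentially" for b
    using v by (simp add: filterlim_at_top_dense)
  have hp: "\<theta> + h > 0" "\<theta> - h > 0" using h \<open>\<theta> > 0\<close> by auto
  show ?thesis
    using bounds[OF \<open>\<theta> > 0\<close>] bounds[OF hp(1)] bounds[OF hp(2)] big[of 0] big[of "ln 4 / (h * \<epsilon> / 4)"] big[of "ln 2 / (\<tau> / 2)"]
  proof eventually_elim
    case (elim N)
    let ?V = "v N"
    let ?p = "prob {\<omega> \<in> space M. X N \<omega> > a - \<epsilon>}"
    have vN: "?V > 0" by fact
    have "ennreal (enn2real (E N \<theta>)) \<le> ennreal (exp (?V * (\<theta> * (a + \<epsilon>))) * ?p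
       + exp (- ?V * (h * (a + \<epsilon>))) * enn2real (E N (\<theta> + h)) + exp (?V * (h * (a - \<epsilon>))) * enn2real (E N (\<theta> - h)))"
      using split[OF vN] elim by (simp add: emeasure_eq_measure ennreal_mult ennreal_plus)
    then have main: "enn2real (E N \<theta>) \<le> exp (?V * (\<theta> * (a + \<epsilon>))) * ?p
       + exp (- ?V * (h * (a + \<epsilon>))) * enn2real (E N (\<theta> + h)) + exp (?V * (h * (a - \<epsilon>))) * enn2real (E N (\<theta> - h))"
      by (subst (asm) ennreal_le_iff) (auto intro!: add_nonneg_nonneg)
    have h\<epsilon>: "?V * (h * \<epsilon> / 4) > ln 4" using elim(5) h \<open>\<epsilon> > 0\<close> by (simp add: field_simps)
    let ?q = "exp (?V * (G \<theta> - \<sigma>))"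
    have small: "exp (?V * (G \<theta> - h * \<epsilon> / 2 + \<sigma>)) \<le> ?q / 4"
    proof -
      have "?V * (G \<theta> - h * \<epsilon> / 2 + \<sigma>) \<le> ?V * (G \<theta> - \<sigma> - h * \<epsilon> / 4)"
        using vN \<sigma>(2) by (intro mult_left_mono) auto
      also have "\<dots> \<le> ?V * (G \<theta> - \<sigma>) - ln 4" using h\<epsilon> by (simp add: algebra_simps)
      finally have "exp (?V * (G \<theta> - h * \<epsilon> / 2 + \<sigma>)) \<le> exp (?V * (G \<theta> - \<sigma>) - ln 4)" by simp
      then show ?thesis by (simp add: exp_diff)
    qed
    have "exp (- ?V * (h * (a + \<epsilon>))) * enn2real (E N (\<theta> + h)) \<le> exp (- ?V * (h * (a + \<epsilon>))) * exp (?V * (G (\<theta> + h) + \<sigma>))"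
      using elim by (intro mult_left_mono) auto
    also have "\<dots> = exp (?V * (G (\<theta> + h) - h * (a + \<epsilon>) + \<sigma>))" by (simp add: exp_add[symmetric] algebra_simps)
    also have "\<dots> \<le> exp (?V * (G \<theta> - h * \<epsilon> / 2 + \<sigma>))" using vN Gp by (simp add: mult_left_mono)
    finally have p1: "exp (- ?V * (h * (a + \<epsilon>))) * enn2real (E N (\<theta> + h)) \<le> ?q / 4" using small by linarith
    have "exp (?V * (h * (a - \<epsilon>))) * enn2real (E N (\<theta> - h)) \<le> exp (?V * (h * (a - \<epsilon>))) * exp (?V * (G (\<theta> - h) + \<sigma>))"
      using elim by (intro mult_left_mono) auto
    also have "\<dots> = exp (?V * (G (\<theta> - h) + h * (a - \<epsilon>) + \<sigma>))" by (simp add: exp_add[symmetric] algebra_simps)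
    also have "\<dots> \<le> exp (?V * (G \<theta> - h * \<epsilon> / 2 + \<sigma>))" using vN Gm by (simp add: mult_left_mono)
    finally have p2: "exp (?V * (h * (a - \<epsilon>))) * enn2real (E N (\<theta> - h)) \<le> ?q / 4" using small by linarith
    have half: "?q / 2 \<le> exp (?V * (\<theta> * (a + \<epsilon>))) * ?p" using main p1 p2 elim by linarith
    have "?V * (\<tau> / 2) > ln 2" using elim(6) \<open>\<tau> > 0\<close> by (simp add: field_simps)
    moreover have "?V * \<sigma> \<le> ?V * (\<tau> / 2)" using vN \<sigma>(3) by simp
    ultimately have "?V * (\<theta> * (a + \<epsilon>)) + ?V * (G \<theta> - \<theta> * (a + \<epsilon>) - \<tau>) \<le> ?V * (G \<theta> - \<sigma>) - ln 2"
      by (simp add: algebra_simps)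
    then have "exp (?V * (\<theta> * (a + \<epsilon>)) + ?V * (G \<theta> - \<theta> * (a + \<epsilon>) - \<tau>)) \<le> exp (?V * (G \<theta> - \<sigma>) - ln 2)" by simp
    also have "\<dots> = ?q / 2" by (simp add: exp_diff)
    finally have "exp (?V * (\<theta> * (a + \<epsilon>))) * exp (?V * (G \<theta> - \<theta> * (a + \<epsilon>) - \<tau>)) \<le> exp (?V * (\<theta> * (a + \<epsilon>))) * ?p"
      using half unfolding exp_add by (rule order_trans)
    then show ?case by (rule mult_left_le_imp_le) simp
  qed
qed

section \<open>Exponential estimates for the queue\<close>
locale queue_model = prob_space M for M :: "'a measure" +
  fixes X :: "nat \<Rightarrow> 'a \<Rightarrow> real" and Q :: "nat \<Rightarrow> 'a \<Rightarrow> nat" and D :: "real measure"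
    and \<Delta> \<mu> t :: real
  assumes law: "positive_law D"
    and indep: "indep_vars (\<lambda>_. borel) X UNIV"
    and distr_X: "\<And>j. distr M borel (X j) = D"
    and queue: "\<And>N. N \<ge> 1 \<Longrightarrow>
      cond_poisson M X (\<lambda>\<omega>. real N * kappa \<mu> t \<Delta> N (\<lambda>j. X j \<omega>)) (Q N)"
    and \<Delta>_pos: "\<Delta> > 0" and \<mu>_pos: "\<mu> > 0" and t_pos: "t > 0"
begin

interpretation D: positive_law D by (rule law)

definition rates_in :: "real set \<Rightarrow> nat \<Rightarrow> 'a set" where
  "rates_in B N = {\<omega> \<in> space M. \<forall>j\<le>nat \<lfloor>t / (\<Delta> / real N)\<rfloor>. X j \<omega> \<in> B}"

text \<open>The exponent is written in terms of the speed \<open>N / \<Delta>\<close> and of the variable \<open>Q N / N\<close>, the form in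
  which the exponential moments enter large-deviation estimates.\<close>
definition queue_mgf :: "real set \<Rightarrow> nat \<Rightarrow> real \<Rightarrow> ennreal" where
  "queue_mgf B N \<theta> =
     (\<integral>\<^sup>+\<omega>. ennreal (exp (\<theta> * (real N / \<Delta>) * (real (Q N \<omega>) / real N))) * indicator (rates_in B N) \<omega> \<partial>M)"

definition scaled_log_tail :: "real \<Rightarrow> nat \<Rightarrow> ereal" where
  "scaled_log_tail a N =
     ereal (\<Delta> / real N) * elog (emeasure M {\<omega> \<in> space M. real (Q N \<omega>) / real N \<ge> a})"

lemma Q_measurable: "N \<ge> 1 \<Longrightarrow> Q N \<in> measurable M (count_space UNIV)"
  using queue by (simp add: cond_poisson_def)

lemma X_measurable [measurable]: "X j \<in> borel_measurable M"
  using indep unfolding indep_vars_def by auto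

lemma rates_in_measurable [measurable]: "B \<in> sets borel \<Longrightarrow> rates_in B N \<in> sets M"
  unfolding rates_in_def
proof -
  assume [measurable]: "B \<in> sets borel"
  have "{\<omega> \<in> space M. \<forall>j\<le>m. X j \<omega> \<in> B} \<in> sets M" for m by measurable
  then show "{\<omega> \<in> space M. \<forall>j\<le>nat \<lfloor>t / (\<Delta> / real N)\<rfloor>. X j \<omega> \<in> B} \<in> sets M" .
qed

lemma tilt_pos: "\<theta> > 0 \<Longrightarrow> tilt \<Delta> \<theta> > 0"
  using \<Delta>_pos by (simp add: tilt_def)

lemma queue_mgf_eq_prod:
  assumes "N \<ge> 1" "B \<in> sets borel"
  shows "queue_mgf B N \<theta> =
    (\<Prod>j\<le>nat \<lfloor>t / (\<Delta> / real N)\<rfloor>. restricted_mgf D B (tilt \<Delta> \<theta> * slot_mean \<mu> t (\<Delta> / real N) j))"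
proof -
  have exponent: "\<theta> * (real N / \<Delta>) * (real (Q N \<omega>) / real N) = \<theta> / \<Delta> * real (Q N \<omega>)" for \<omega>
    using assms(1) by simp
  show ?thesis
    unfolding queue_mgf_def rates_in_def tilt_def exponent
    by (rule queue_restricted_mgf[OF law indep distr_X queue[OF assms(1)] \<mu>_pos t_pos \<Delta>_pos assms(1,2)])
qed

lemma queue_mgf_cumulant:
  assumes N: "N \<ge> 1" and B: "B \<in> sets borel" "emeasure D B > 0"
    and "\<theta> > 0" and fin: "restricted_mgf D B (tilt \<Delta> \<theta>) < \<infinity>"
  shows "0 < queue_mgf B N \<theta>" "queue_mgf B N \<theta> < \<infinity>"
    "ln (enn2real (queue_mgf B N \<theta>)) =
      (\<Sum>j\<le>nat \<lfloor>t / (\<Delta> / real N)\<rfloor>. restricted_cgf D B (tilt \<Delta> \<theta> * slot_mean \<mu> t (\<Delta> / real N) j))"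
proof -
  let ?y = "\<lambda>j. tilt \<Delta> \<theta> * slot_mean \<mu> t (\<Delta> / real N) j"
  let ?m = "\<lambda>j. enn2real (restricted_mgf D B (?y j))"
  have \<delta>: "\<Delta> / real N > 0" using N \<Delta>_pos by simp
  have y: "0 \<le> ?y j" "?y j \<le> tilt \<Delta> \<theta>" for j
    using slot_mean_range[OF \<mu>_pos t_pos \<delta>, of j] tilt_pos[OF \<open>\<theta> > 0\<close>] by (auto intro: mult_left_le)
  have f: "restricted_mgf D B (?y j) < \<infinity>" for j by (rule D.restricted_mgf_finite_le[OF fin y(2)])
  have p: "?m j > 0" for j by (rule D.enn2real_restricted_mgf_pos[OF B f y(1)])
  have "queue_mgf B N \<theta> = (\<Prod>j\<le>nat \<lfloor>t / (\<Delta> / real N)\<rfloor>. ennreal (?m j))"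
    unfolding queue_mgf_eq_prod[OF N B(1)] using f by (intro prod.cong) auto
  also have "\<dots> = ennreal (\<Prod>j\<le>nat \<lfloor>t / (\<Delta> / real N)\<rfloor>. ?m j)"
    using less_imp_le[OF p] by (intro prod_ennreal)
  finally have eq: "queue_mgf B N \<theta> = ennreal (\<Prod>j\<le>nat \<lfloor>t / (\<Delta> / real N)\<rfloor>. ?m j)" .
  have pp: "(\<Prod>j\<le>nat \<lfloor>t / (\<Delta> / real N)\<rfloor>. ?m j) > 0" using p by (intro prod_pos) auto
  show "0 < queue_mgf B N \<theta>" "queue_mgf B N \<theta> < \<infinity>" unfolding eq using pp by simp_all
  show "ln (enn2real (queue_mgf B N \<theta>)) =
      (\<Sum>j\<le>nat \<lfloor>t / (\<Delta> / real N)\<rfloor>. restricted_cgf D B (?y j))"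
    unfolding eq restricted_cgf_def enn2real_ennreal[OF less_imp_le[OF pp]]
    by (rule ln_prod[OF finite_atMost]) (rule less_imp_neq[OF p, symmetric])
qed

lemma queue_mgf_cumulant_limit:
  assumes B: "B \<in> sets borel" "emeasure D B > 0"
    and "\<theta> > 0" and fin: "restricted_mgf D B (tilt \<Delta> \<theta>) < \<infinity>"
  shows "(\<lambda>N. ln (enn2real (queue_mgf B N \<theta>)) / (real N / \<Delta>)) \<longlonglongrightarrow> limit_cgf D B \<mu> t (tilt \<Delta> \<theta>)"
proof -
  have "(\<lambda>N. \<Delta> / real N * (\<Sum>j\<le>nat \<lfloor>t / (\<Delta> / real N)\<rfloor>. restricted_cgf D B (tilt \<Delta> \<theta> * slot_mean \<mu> t (\<Delta> / real N) j)))
     \<longlonglongrightarrow> limit_cgf D B \<mu> t (tilt \<Delta> \<theta>)"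
    unfolding limit_cgf_def
  proof (rule slot_sum_tendsto_integral[where h = "restricted_cgf D B", OF \<mu>_pos t_pos])
    show "0 \<le> tilt \<Delta> \<theta>" using tilt_pos[OF \<open>\<theta> > 0\<close>] by simp
    show "continuous_on {0..tilt \<Delta> \<theta>} (restricted_cgf D B)"
      by (rule D.continuous_restricted_cgf[OF B fin])
    show "(\<lambda>N. \<Delta> / real N) \<longlonglongrightarrow> 0" by (rule lim_const_over_n)
    show "0 < \<Delta> / real N" if "N \<ge> 1" for N using that \<Delta>_pos by simp
  qed
  moreover have "eventually (\<lambda>N. \<Delta> / real N * (\<Sum>j\<le>nat \<lfloor>t / (\<Delta> / real N)\<rfloor>. restricted_cgf D B (tilt \<Delta> \<theta> * slot_mean \<mu> t (\<Delta> / real N) j))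
    = ln (enn2real (queue_mgf B N \<theta>)) / (real N / \<Delta>)) sequentially"
    using eventually_ge_at_top[of 1]
    by eventually_elim (simp only: queue_mgf_cumulant(3)[OF _ assms] divide_divide_eq_right times_divide_eq_left mult.commute)
  ultimately show ?thesis by (rule Lim_transform_eventually)
qed

text \<open>The exponential Markov inequality, with no restriction on the rates.\<close>
lemma queue_tail_upper:
  assumes "\<theta> > 0" and fin: "restricted_mgf D UNIV (tilt \<Delta> \<theta>) < \<infinity>"
  shows "limsup (scaled_log_tail a) \<le> ereal (limit_cgf D UNIV \<mu> t (tilt \<Delta> \<theta>) - \<theta> * a)"
proof -
  have U: "UNIV \<in> sets (borel :: real measure)" "emeasure D UNIV > 0"
    using D.emeasure_space_1 sets_eq_imp_space_eq[OF D.sets_D] by auto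
  let ?u = "\<lambda>N. ln (enn2real (queue_mgf UNIV N \<theta>)) / (real N / \<Delta>) - \<theta> * a"
  have le: "scaled_log_tail a N \<le> ereal (?u N)" if N: "N \<ge> 1" for N
  proof -
    let ?S = "{\<omega> \<in> space M. real (Q N \<omega>) / real N \<ge> a}"
    note [measurable] = Q_measurable[OF N]
    have S: "?S \<in> sets M" by measurable
    have v: "real N / \<Delta> > 0" using N \<Delta>_pos by simp
    note qm = queue_mgf_cumulant(1,2)[OF N U assms]
    have qp: "enn2real (queue_mgf UNIV N \<theta>) > 0" using qm by (simp add: enn2real_positive_iff)
    have "emeasure M ?S = (\<integral>\<^sup>+\<omega>. indicator ?S \<omega> \<partial>M)" using S by simp
    also have "\<dots> \<le> (\<integral>\<^sup>+\<omega>. ennreal (exp (- (\<theta> * (real N / \<Delta>) * a))) *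
        (ennreal (exp (\<theta> * (real N / \<Delta>) * (real (Q N \<omega>) / real N))) * indicator (rates_in UNIV N) \<omega>) \<partial>M)"
    proof (rule nn_integral_mono)
      fix \<omega> assume w: "\<omega> \<in> space M"
      show "indicator ?S \<omega> \<le> ennreal (exp (- (\<theta> * (real N / \<Delta>) * a))) *
        (ennreal (exp (\<theta> * (real N / \<Delta>) * (real (Q N \<omega>) / real N))) * indicator (rates_in UNIV N) \<omega>)"
      proof (cases "\<omega> \<in> ?S")
        case True
        then have "\<theta> * (real N / \<Delta>) * a \<le> \<theta> * (real N / \<Delta>) * (real (Q N \<omega>) / real N)"
          using less_imp_le[OF v] \<open>\<theta> > 0\<close> by (intro mult_left_mono mult_nonneg_nonneg) auto
        then show ?thesis using True w
          by (simp add: rates_in_def ennreal_mult[symmetric] exp_add[symmetric])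
      qed simp
    qed
    also have "\<dots> = ennreal (exp (- (\<theta> * (real N / \<Delta>) * a))) * queue_mgf UNIV N \<theta>"
      unfolding queue_mgf_def by (rule nn_integral_cmult) measurable
    also have "\<dots> = ennreal (exp (- (\<theta> * (real N / \<Delta>) * a)) * enn2real (queue_mgf UNIV N \<theta>))"
      using qm by (simp add: ennreal_mult)
    finally have p: "prob ?S \<le> exp (- (\<theta> * (real N / \<Delta>) * a)) * enn2real (queue_mgf UNIV N \<theta>)"
      using qp by (simp add: emeasure_eq_measure)
    show ?thesis
    proof (cases "prob ?S = 0")
      case True
      then show ?thesis using N \<Delta>_pos by (simp add: scaled_log_tail_def elog_def emeasure_eq_measure)
    next
      case False
      then have pp: "prob ?S > 0" by (simp add: zero_less_measure_iff)
      have "ln (prob ?S) \<le> ln (exp (- (\<theta> * (real N / \<Delta>) * a)) * enn2real (queue_mgf UNIV N \<theta>))"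
        using p pp qp by simp
      also have "\<dots> = - (\<theta> * (real N / \<Delta>) * a) + ln (enn2real (queue_mgf UNIV N \<theta>))"
        using qp by (simp add: ln_mult)
      finally have "\<Delta> / real N * ln (prob ?S) \<le> \<Delta> / real N * (- (\<theta> * (real N / \<Delta>) * a) + ln (enn2real (queue_mgf UNIV N \<theta>)))"
        using \<Delta>_pos by (intro mult_left_mono) auto
      also have "\<dots> = ?u N" using N \<Delta>_pos by (simp add: field_simps)
      finally show ?thesis using pp by (simp add: scaled_log_tail_def elog_def emeasure_eq_measure)
    qed
  qed
  have "limsup (scaled_log_tail a) \<le> limsup (\<lambda>N. ereal (?u N))"
    by (rule Limsup_mono, use eventually_ge_at_top[of 1] in eventually_elim) (rule le)
  also have "limsup (\<lambda>N. ereal (?u N)) = ereal (limit_cgf D UNIV \<mu> t (tilt \<Delta> \<theta>) - \<theta> * a)"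
    by (rule lim_imp_Limsup[OF sequentially_bot tendsto_ereal[OF
          tendsto_diff[OF queue_mgf_cumulant_limit[OF U assms] tendsto_const]]])
  finally show ?thesis .
qed

text \<open>Restricting the rates to \<open>B\<close> can only decrease the tail probability. The tilt is centred at
  \<open>a + \<epsilon>\<close>, so that the window of width \<open>\<epsilon>\<close> around the centre lies above \<open>a\<close>.\<close>
lemma queue_tail_lower:
  assumes B: "B \<in> sets borel" "emeasure D B > 0"
    and fin: "\<And>y. y \<ge> 0 \<Longrightarrow> restricted_mgf D B y < \<infinity>"
    and "\<theta> > 0" "\<epsilon> > 0"
    and deriv: "((\<lambda>\<eta>. limit_cgf D B \<mu> t (tilt \<Delta> \<eta>)) has_real_derivative a + \<epsilon>) (at \<theta>)"
  shows "ereal (limit_cgf D B \<mu> t (tilt \<Delta> \<theta>) - \<theta> * (a + 2 * \<epsilon>)) \<le> liminf (scaled_log_tail a)"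
proof (rule ereal_le_epsilon2)
  fix \<tau> :: real assume "\<tau> > 0"
  let ?G = "\<lambda>\<eta>. limit_cgf D B \<mu> t (tilt \<Delta> \<eta>)"
  let ?b = "?G \<theta> - \<theta> * (a + 2 * \<epsilon>) - \<tau>"
  \<comment> \<open>the case distinction makes the variable measurable also for \<open>N = 0\<close>, where nothing is known about \<open>Q\<close>\<close>
  define Y where "Y = (\<lambda>N \<omega>. if N \<ge> 1 then real (Q N \<omega>) / real N else 0)"
  have Y: "Y N \<in> borel_measurable M" for N
  proof (cases "N \<ge> 1")
    case True
    note [measurable] = Q_measurable[OF True]
    show ?thesis using True by (simp add: Y_def)
  qed (simp add: Y_def)
  have qY: "(\<integral>\<^sup>+\<omega>. ennreal (exp (\<eta> * (real N / \<Delta>) * Y N \<omega>)) * indicator (rates_in B N) \<omega> \<partial>M) = queue_mgf B N \<eta>"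
    if "N \<ge> 1" for N \<eta>
    using that by (simp add: queue_mgf_def Y_def)
  have v: "filterlim (\<lambda>N. real N / \<Delta>) at_top sequentially"
    using filterlim_tendsto_pos_mult_at_top[OF tendsto_const _ filterlim_real_sequentially, of "1 / \<Delta>"] \<Delta>_pos
    by simp
  have "eventually (\<lambda>N. exp (real N / \<Delta> * (?G \<theta> - \<theta> * ((a + \<epsilon>) + \<epsilon>) - \<tau>)) \<le> prob {\<omega> \<in> space M. Y N \<omega> > (a + \<epsilon>) - \<epsilon>}) sequentially"
  proof (rule mgf_limit_lower_bound[where A = "rates_in B"])
    fix \<eta> :: real assume \<eta>: "\<eta> > 0"
    have f: "restricted_mgf D B (tilt \<Delta> \<eta>) < \<infinity>" using tilt_pos[OF \<eta>] by (intro fin) simp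
    show "\<forall>\<^sub>F N in sequentially. 0 < (\<integral>\<^sup>+\<omega>. ennreal (exp (\<eta> * (real N / \<Delta>) * Y N \<omega>)) * indicator (rates_in B N) \<omega> \<partial>M) \<and>
        (\<integral>\<^sup>+\<omega>. ennreal (exp (\<eta> * (real N / \<Delta>) * Y N \<omega>)) * indicator (rates_in B N) \<omega> \<partial>M) < \<infinity>"
      using eventually_ge_at_top[of 1]
      by eventually_elim (simp only: qY queue_mgf_cumulant(1,2)[OF _ B \<eta> f])
    show "(\<lambda>N. ln (enn2real (\<integral>\<^sup>+\<omega>. ennreal (exp (\<eta> * (real N / \<Delta>) * Y N \<omega>)) * indicator (rates_in B N) \<omega> \<partial>M)) / (real N / \<Delta>)) \<longlonglongrightarrow> ?G \<eta>"
    proof (rule Lim_transform_eventually[OF queue_mgf_cumulant_limit[OF B \<eta> f]])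
      show "\<forall>\<^sub>F N in sequentially. ln (enn2real (queue_mgf B N \<eta>)) / (real N / \<Delta>) =
        ln (enn2real (\<integral>\<^sup>+\<omega>. ennreal (exp (\<eta> * (real N / \<Delta>) * Y N \<omega>)) * indicator (rates_in B N) \<omega> \<partial>M)) / (real N / \<Delta>)"
        using eventually_ge_at_top[of 1] by eventually_elim (simp only: qY)
    qed
  qed (fact Y rates_in_measurable[OF B(1)] v deriv \<open>\<theta> > 0\<close> \<open>\<epsilon> > 0\<close> \<open>\<tau> > 0\<close>)+
  then have "eventually (\<lambda>N. ereal ?b \<le> scaled_log_tail a N) sequentially"
    using eventually_ge_at_top[of 1]
  proof eventually_elim
    case (elim N)
    let ?S = "{\<omega> \<in> space M. real (Q N \<omega>) / real N \<ge> a}"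
    note [measurable] = Q_measurable[OF elim(2)]
    have "exp (real N / \<Delta> * ?b) \<le> prob {\<omega> \<in> space M. Y N \<omega> > a}" using elim(1) by (simp add: algebra_simps)
    also have "\<dots> \<le> prob ?S" using elim(2) by (intro finite_measure_mono) (auto simp: Y_def)
    finally have le: "exp (real N / \<Delta> * ?b) \<le> prob ?S" .
    then have pp: "prob ?S > 0" by (rule less_le_trans[OF exp_gt_zero])
    have "real N / \<Delta> * ?b \<le> ln (prob ?S)" using le pp by (simp add: ln_ge_iff)
    then have "\<Delta> / real N * (real N / \<Delta> * ?b) \<le> \<Delta> / real N * ln (prob ?S)"
      using \<Delta>_pos by (intro mult_left_mono) auto
    then have "?b \<le> \<Delta> / real N * ln (prob ?S)" using \<Delta>_pos elim(2) by simp
    then show ?case using pp by (simp add: scaled_log_tail_def elog_def emeasure_eq_measure)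
  qed
  then have "ereal ?b \<le> liminf (scaled_log_tail a)" by (rule Liminf_bounded)
  then have "ereal ?b + ereal \<tau> \<le> liminf (scaled_log_tail a) + ereal \<tau>" by (rule add_right_mono)
  then show "ereal (?G \<theta> - \<theta> * (a + 2 * \<epsilon>)) \<le> liminf (scaled_log_tail a) + ereal \<tau>" by simp
qed

end

section \<open>The limiting cumulant function and its truncations\<close>

text \<open>The same integral as in the limiting cumulant function, for the unrestricted law and with the value
  infinity admitted.\<close>
definition cgf_integral :: "real measure \<Rightarrow> real \<Rightarrow> real \<Rightarrow> real \<Rightarrow> ennreal" where
  "cgf_integral D \<mu> t c =
     (\<integral>\<^sup>+s\<in>{0..t}. e2ennreal (elog (restricted_mgf D UNIV (c * exp (- \<mu> * s)))) \<partial>lborel)"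

lemma nn_integral_Icc_continuous:
  fixes f :: "real \<Rightarrow> real"
  assumes "continuous_on {a..b} f" "\<And>x. x \<in> {a..b} \<Longrightarrow> 0 \<le> f x"
  shows "(\<integral>\<^sup>+x\<in>{a..b}. ennreal (f x) \<partial>lborel) = ennreal (integral {a..b} f)"
proof -
  have si: "set_integrable lborel {a..b} f" by (rule borel_integrable_atLeastAtMost'[OF assms(1)])
  have "(\<integral>\<^sup>+x\<in>{a..b}. ennreal (f x) \<partial>lborel) = (\<integral>\<^sup>+x. ennreal (indicator {a..b} x *\<^sub>R f x) \<partial>lborel)"
    by (intro nn_integral_cong) (auto simp: indicator_def)
  also have "\<dots> = ennreal (LINT x:{a..b}|lborel. f x)"
    unfolding set_lebesgue_integral_def
    by (rule nn_integral_eq_integral)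
       (use si assms(2) in \<open>auto simp: set_integrable_def indicator_def\<close>)
  finally show ?thesis using set_borel_integral_eq_integral(2)[OF si] by simp
qed

lemma elog_mono:
  assumes "x \<le> y"
  shows "elog x \<le> elog y"
proof (cases "x = 0 \<or> y = \<top>")
  case False
  then have "x \<noteq> 0" "y \<noteq> 0" "x \<noteq> \<top>" "y \<noteq> \<top>"
    using assms by (auto simp: top_unique)
  moreover from this have "0 < enn2real x" "enn2real x \<le> enn2real y"
    using assms by (auto simp: enn2real_positive_iff less_top zero_less_iff_neq_zero intro: enn2real_mono)
  ultimately show ?thesis by (simp add: elog_def)
qed (auto simp: elog_def)

lemma mult_exp_decay_le:
  fixes c \<mu> s t :: real
  assumes "0 \<le> c" "0 < \<mu>" "s \<in> {0..t}"
  shows "0 \<le> c * exp (- \<mu> * s)" "c * exp (- \<mu> * s) \<le> c"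
  using assms mult_left_le[of "exp (- \<mu> * s)" c] by auto
context positive_law
begin

lemma emeasure_UNIV_pos: "emeasure D UNIV > 0"
  using emeasure_space_1 sets_eq_imp_space_eq[OF sets_D] by auto

lemma restricted_cgf_mono:
  assumes "B \<in> sets borel" "emeasure D B > 0" "restricted_mgf D B' y < \<infinity>" "0 \<le> y" "B \<subseteq> B'"
  shows "restricted_cgf D B y \<le> restricted_cgf D B' y"
proof -
  have le: "restricted_mgf D B y \<le> restricted_mgf D B' y" by (rule restricted_mgf_mono[OF order_refl assms(5)])
  then have "restricted_mgf D B y < \<infinity>" using assms(3) by (rule le_less_trans)
  then have "0 < enn2real (restricted_mgf D B y)" using assms by (intro enn2real_restricted_mgf_pos)
  moreover have "enn2real (restricted_mgf D B y) \<le> enn2real (restricted_mgf D B' y)"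
    using le assms(3) by (intro enn2real_mono) auto
  ultimately show ?thesis unfolding restricted_cgf_def by simp
qed

lemma restricted_cgf_ge_ln_prob:
  assumes B: "B \<in> sets borel" "measure D B > 0" and fin: "restricted_mgf D B y < \<infinity>" and "0 \<le> y"
  shows "ln (measure D B) \<le> restricted_cgf D B y"
proof -
  have "enn2real (emeasure D B) \<le> enn2real (restricted_mgf D B y)"
    using restricted_mgf_mono[OF \<open>0 \<le> y\<close> order_refl, of B] fin
    by (intro enn2real_mono) (auto simp: restricted_mgf_0[OF B(1)])
  then show ?thesis using B(2) by (simp add: restricted_cgf_def measure_def)
qed

lemma restricted_cgf_ge:
  assumes S: "S \<subseteq> B" "S \<in> sets borel" "measure D S > 0" "\<And>x. x \<in> S \<Longrightarrow> \<epsilon> \<le> x"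
    and fin: "restricted_mgf D B y < \<infinity>" and "0 \<le> y"
  shows "ln (measure D S) + \<epsilon> * y \<le> restricted_cgf D B y"
proof -
  have "ennreal (exp (y * \<epsilon>) * measure D S) = (\<integral>\<^sup>+x. ennreal (exp (y * \<epsilon>)) * indicator S x \<partial>D)"
    using S(2) by (simp add: nn_integral_cmult_indicator sets_D emeasure_eq_measure ennreal_mult)
  also have "\<dots> \<le> restricted_mgf D B y"
    unfolding restricted_mgf_def
    by (intro nn_integral_mono) (use S \<open>0 \<le> y\<close> in \<open>auto simp: indicator_def intro!: ennreal_leI mult_left_mono\<close>)
  finally have "enn2real (ennreal (exp (y * \<epsilon>) * measure D S)) \<le> enn2real (restricted_mgf D B y)"
    using fin by (intro enn2real_mono) auto
  then have le: "exp (y * \<epsilon>) * measure D S \<le> enn2real (restricted_mgf D B y)" by simp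
  moreover have "exp (y * \<epsilon>) * measure D S > 0" using S(3) by simp
  ultimately have "ln (exp (y * \<epsilon>) * measure D S) \<le> restricted_cgf D B y"
    unfolding restricted_cgf_def by simp
  then show ?thesis using S(3) by (simp add: ln_mult mult.commute)
qed

lemma continuous_cgf_profile:
  assumes "B \<in> sets borel" "emeasure D B > 0" "restricted_mgf D B c < \<infinity>" "0 \<le> c" "0 < \<mu>"
  shows "continuous_on {0..t} (\<lambda>s. restricted_cgf D B (c * exp (- \<mu> * s)))"
proof (rule continuous_on_compose2[OF continuous_restricted_cgf[OF assms(1-3)]])
  show "(\<lambda>s. c * exp (- \<mu> * s)) ` {0..t} \<subseteq> {0..c}"
    using assms(4,5) by (auto intro!: mult_left_le)
qed (intro continuous_intros)

lemma cgf_profile_integrable: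
  assumes "B \<in> sets borel" "emeasure D B > 0" "restricted_mgf D B c < \<infinity>" "0 \<le> c" "0 < \<mu>"
  shows "(\<lambda>s. restricted_cgf D B (c * exp (- \<mu> * s))) integrable_on {0..t}"
  by (rule integrable_continuous_real[OF continuous_cgf_profile[OF assms]])

lemma limit_cgf_mono:
  assumes "B \<in> sets borel" "emeasure D B > 0" "B' \<in> sets borel" "restricted_mgf D B' c < \<infinity>"
    "0 \<le> c" "0 < \<mu>" "B \<subseteq> B'"
  shows "limit_cgf D B \<mu> t c \<le> limit_cgf D B' \<mu> t c"
proof -
  have B': "emeasure D B' > 0"
    using assms(2) emeasure_mono[OF assms(7), of D] assms(3) by (auto simp: sets_D)
  have fB: "restricted_mgf D B c < \<infinity>"
    using restricted_mgf_mono[OF order_refl assms(7)] assms(4) by (rule le_less_trans)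
  show ?thesis unfolding limit_cgf_def
  proof (rule integral_le)
    fix s assume s: "s \<in> {0..t}"
    show "restricted_cgf D B (c * exp (- \<mu> * s)) \<le> restricted_cgf D B' (c * exp (- \<mu> * s))"
      by (intro restricted_cgf_mono assms restricted_mgf_finite_le[OF assms(4)]
            mult_exp_decay_le[OF assms(5,6) s])
  qed (intro cgf_profile_integrable assms B' fB)+
qed

text \<open>Mass \<open>q\<close> at or above some \<open>\<epsilon> > 0\<close> forces linear growth in \<open>c\<close>, hence exponential growth in
  \<open>\<theta>\<close> for \<open>c = tilt \<Delta> \<theta>\<close>; this is what makes the truncated variational problems coercive.\<close>
lemma limit_cgf_ge:
  assumes S: "S \<subseteq> B" "S \<in> sets borel" "measure D S > 0" "\<And>x. x \<in> S \<Longrightarrow> \<epsilon> \<le> x"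
    and B: "B \<in> sets borel" and fin: "restricted_mgf D B c < \<infinity>"
    and "0 \<le> c" "0 < \<mu>" "0 < t" "0 \<le> \<epsilon>"
  shows "t * (ln (measure D S) + \<epsilon> * (c * exp (- \<mu> * t))) \<le> limit_cgf D B \<mu> t c"
proof -
  have "0 < emeasure D S" using S(3) by (simp add: emeasure_eq_measure)
  also have "\<dots> \<le> emeasure D B" using S(1) B by (intro emeasure_mono) (auto simp: sets_D)
  finally have Bp: "emeasure D B > 0" .
  have "integral {0..t} (\<lambda>s. ln (measure D S) + \<epsilon> * (c * exp (- \<mu> * t))) \<le> limit_cgf D B \<mu> t c"
    unfolding limit_cgf_def
  proof (rule integral_le)
    fix s assume s: "s \<in> {0..t}"
    have "\<epsilon> * (c * exp (- \<mu> * t)) \<le> \<epsilon> * (c * exp (- \<mu> * s))"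
      using s assms by (intro mult_left_mono) auto
    moreover have "ln (measure D S) + \<epsilon> * (c * exp (- \<mu> * s)) \<le> restricted_cgf D B (c * exp (- \<mu> * s))"
      by (intro restricted_cgf_ge[OF S] restricted_mgf_finite_le[OF fin] mult_exp_decay_le[OF \<open>0 \<le> c\<close> \<open>0 < \<mu>\<close> s])
    ultimately show "ln (measure D S) + \<epsilon> * (c * exp (- \<mu> * t)) \<le> restricted_cgf D B (c * exp (- \<mu> * s))" by linarith
  qed (intro integrable_const_ivl cgf_profile_integrable B Bp fin assms)+
  then show ?thesis using \<open>0 < t\<close> by simp
qed

text \<open>With \<open>c = exp (- \<mu> x)\<close> the integrand becomes a fixed continuous function of \<open>s + x\<close>.
  Its integral over \<open>[0, t]\<close> is therefore a difference of two values of one antiderivative, and no derivative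
  has to be taken under the integral.\<close>
lemma limit_cgf_tilt_differentiable:
  assumes B: "B \<in> sets borel" "emeasure D B > 0"
    and fin: "\<And>y. 0 \<le> y \<Longrightarrow> restricted_mgf D B y < \<infinity>"
    and pos: "0 < \<mu>" "0 < t" "0 < \<Delta>" "0 < \<theta>"
  shows "\<exists>d. ((\<lambda>\<eta>. limit_cgf D B \<mu> t (tilt \<Delta> \<eta>)) has_real_derivative d) (at \<theta>)"
proof -
  define k where "k = (\<lambda>v. restricted_cgf D B (exp (- \<mu> * v)))"
  have "continuous_on {0<..} (restricted_cgf D B)"
    unfolding continuous_on_eq_continuous_at[OF open_greaterThan]
  proof
    fix y :: real assume y: "y \<in> {0<..}"
    have "continuous_on {0<..<y+1} (restricted_cgf D B)"
      by (rule continuous_on_subset[OF continuous_restricted_cgf[OF B fin, of "y + 1"]]) (use y in auto)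
    then show "isCont (restricted_cgf D B) y"
      using y by (auto simp: continuous_on_eq_continuous_at)
  qed
  then have "continuous_on UNIV k" unfolding k_def
    by (rule continuous_on_compose2) (auto intro!: continuous_intros)
  then have "isCont k v" for v by (simp add: continuous_on_eq_continuous_at)
  then obtain A where A: "\<And>v. (A has_vector_derivative k v) (at v)"
    using einterval_antiderivative[of "-\<infinity>" \<infinity> k] by auto
  have A': "(A has_real_derivative k v) (at v)" for v
    using A by (simp add: has_real_derivative_iff_has_vector_derivative)
  define x where "x = (\<lambda>\<eta>. - ln (tilt \<Delta> \<eta>) / \<mu>)"
  have tp: "tilt \<Delta> \<eta> > 0" if "\<eta> > 0" for \<eta> using that pos by (simp add: tilt_def)
  have eq: "limit_cgf D B \<mu> t (tilt \<Delta> \<eta>) = A (t + x \<eta>) - A (x \<eta>)" if \<eta>: "\<eta> > 0" for \<eta>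
  proof -
    have "((\<lambda>s. k (s + x \<eta>)) has_integral (A (t + x \<eta>) - A (0 + x \<eta>))) {0..t}"
    proof (rule fundamental_theorem_of_calculus)
      fix s assume "s \<in> {0..t}"
      have "((\<lambda>s. A (s + x \<eta>)) has_real_derivative k (s + x \<eta>)) (at s)"
        by (rule DERIV_shift[THEN iffD1, OF A'])
      then show "((\<lambda>s. A (s + x \<eta>)) has_vector_derivative k (s + x \<eta>)) (at s within {0..t})"
        by (auto simp: has_real_derivative_iff_has_vector_derivative intro: has_vector_derivative_at_within)
    qed (use pos in simp)
    moreover have "k (s + x \<eta>) = restricted_cgf D B (tilt \<Delta> \<eta> * exp (- \<mu> * s))" for s
    proof -
      have "- \<mu> * (s + x \<eta>) = ln (tilt \<Delta> \<eta>) + - \<mu> * s" using pos by (simp add: x_def field_simps)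
      then have "exp (- \<mu> * (s + x \<eta>)) = tilt \<Delta> \<eta> * exp (- \<mu> * s)"
        using tp[OF \<eta>] by (simp only: exp_add exp_ln)
      then show ?thesis unfolding k_def by (simp only:)
    qed
    ultimately show ?thesis unfolding limit_cgf_def by (simp add: integral_unique)
  qed
  obtain x' where x': "(x has_real_derivative x') (at \<theta>)"
  proof
    show "(x has_real_derivative - ((exp (\<theta> / \<Delta>)) / tilt \<Delta> \<theta>) / \<mu>) (at \<theta>)"
      unfolding x_def tilt_def using pos tp[OF \<open>0 < \<theta>\<close>]
      by (auto intro!: derivative_eq_intros simp: tilt_def)
  qed
  have "((\<lambda>\<eta>. t + x \<eta>) has_real_derivative x') (at \<theta>)"
    by (rule derivative_eq_intros x' refl | simp)+
  then have "((\<lambda>\<eta>. A (t + x \<eta>) - A (x \<eta>)) has_real_derivative k (t + x \<theta>) * x' - k (x \<theta>) * x') (at \<theta>)"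
    by (intro DERIV_diff DERIV_chain2[OF A'] x')
  then have "((\<lambda>\<eta>. limit_cgf D B \<mu> t (tilt \<Delta> \<eta>)) has_real_derivative k (t + x \<theta>) * x' - k (x \<theta>) * x') (at \<theta>)"
    by (rule has_field_derivative_transform_within_open[where S = "{0<..}"]) (use pos eq in auto)
  then show ?thesis ..
qed

lemma cgf_integral_finite:
  assumes fin: "restricted_mgf D UNIV c < \<infinity>" and "0 \<le> c" "0 < \<mu>"
  shows "cgf_integral D \<mu> t c = ennreal (limit_cgf D UNIV \<mu> t c)" "0 \<le> limit_cgf D UNIV \<mu> t c"
proof -
  let ?f = "\<lambda>s. restricted_cgf D UNIV (c * exp (- \<mu> * s))"
  have one: "measure D UNIV = 1" using prob_space sets_eq_imp_space_eq[OF sets_D] by simp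
  have nn: "0 \<le> ?f s" if "s \<in> {0..t}" for s
    using restricted_cgf_ge_ln_prob[of UNIV "c * exp (- \<mu> * s)"] mult_exp_decay_le[OF assms(2,3) that]
      restricted_mgf_finite_le[OF fin] by (simp add: one)
  have "cgf_integral D \<mu> t c = (\<integral>\<^sup>+s\<in>{0..t}. ennreal (?f s) \<partial>lborel)"
    unfolding cgf_integral_def
  proof (intro nn_integral_cong)
    fix s :: real
    show "e2ennreal (elog (restricted_mgf D UNIV (c * exp (- \<mu> * s)))) * indicator {0..t} s
        = ennreal (?f s) * indicator {0..t} s"
    proof (cases "s \<in> {0..t}")
      case True
      note y = mult_exp_decay_le[OF assms(2,3) True]
      have "restricted_mgf D UNIV (c * exp (- \<mu> * s)) \<noteq> 0"
        using restricted_mgf_pos[OF _ emeasure_UNIV_pos y(1)] by auto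
      then show ?thesis
        using restricted_mgf_finite_le[OF fin y(2)] by (simp add: elog_def restricted_cgf_def)
    qed simp
  qed
  also have "\<dots> = ennreal (limit_cgf D UNIV \<mu> t c)"
    unfolding limit_cgf_def
    by (rule nn_integral_Icc_continuous[OF continuous_cgf_profile nn]) (use assms emeasure_UNIV_pos in auto)
  finally show "cgf_integral D \<mu> t c = ennreal (limit_cgf D UNIV \<mu> t c)" .
  show "0 \<le> limit_cgf D UNIV \<mu> t c"
    unfolding limit_cgf_def
    by (rule integral_nonneg[OF cgf_profile_integrable nn]) (use assms emeasure_UNIV_pos in auto)
qed

lemma cgf_integral_mono:
  assumes "0 \<le> c" "c \<le> c'"
  shows "cgf_integral D \<mu> t c \<le> cgf_integral D \<mu> t c'"
  unfolding cgf_integral_def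
  by (intro nn_integral_mono mult_right_mono e2ennreal_mono elog_mono restricted_mgf_mono)
     (use assms in auto)

text \<open>If the transform is infinite at \<open>c'\<close>, it is infinite at \<open>c exp (- \<mu> s)\<close> for all small
  \<open>s\<close>, and the integral diverges.\<close>
lemma mgf_finite_if_cgf_integral_finite:
  assumes L: "cgf_integral D \<mu> t c < \<infinity>" and c: "0 < c'" "c' < c" and pos: "0 < \<mu>" "0 < t"
  shows "restricted_mgf D UNIV c' < \<infinity>"
proof (rule ccontr)
  assume "\<not> restricted_mgf D UNIV c' < \<infinity>"
  then have inf: "restricted_mgf D UNIV c' = \<top>" by (simp add: less_top[symmetric])
  define s0 where "s0 = min t (ln (c / c') / \<mu>)"
  have s0: "0 < s0" "s0 \<le> t" using c pos by (auto simp: s0_def)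
  have "\<infinity> * emeasure lborel {0..s0} = (\<integral>\<^sup>+s. \<infinity> * indicator {0..s0} s \<partial>lborel)"
    by (simp add: nn_integral_cmult_indicator)
  also have "\<dots> \<le> cgf_integral D \<mu> t c"
    unfolding cgf_integral_def
  proof (rule nn_integral_mono)
    fix s :: real
    show "\<infinity> * indicator {0..s0} s \<le> e2ennreal (elog (restricted_mgf D UNIV (c * exp (- \<mu> * s)))) * indicator {0..t} s"
    proof (cases "s \<in> {0..s0}")
      case True
      then have "\<mu> * s \<le> ln (c / c')" using pos by (auto simp: s0_def field_simps)
      then have "exp (\<mu> * s) \<le> c / c'" using c by (metis divide_pos_pos exp_le_cancel_iff exp_ln less_trans)
      then have "c' \<le> c * exp (- \<mu> * s)" using c by (simp add: exp_minus field_simps)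
      then have "restricted_mgf D UNIV (c * exp (- \<mu> * s)) = \<top>"
        using restricted_mgf_mono[of c' "c * exp (- \<mu> * s)" UNIV UNIV] inf by (simp add: top_unique)
      then show ?thesis using True s0 by (simp add: elog_def)
    qed simp
  qed
  finally have "\<infinity> * emeasure lborel {0..s0} < \<infinity>" using L by (rule le_less_trans)
  then show False using s0 by (simp add: ennreal_top_mult)
qed

lemma prob_atMost_tendsto: "(\<lambda>K. measure D {..real K}) \<longlonglongrightarrow> 1"
proof -
  have "(\<lambda>K. emeasure D {..real K}) \<longlonglongrightarrow> emeasure D UNIV"
    using restricted_mgf_atMost_tendsto[of 0] by (simp add: restricted_mgf_0)
  moreover have "emeasure D UNIV = ennreal 1"
    using emeasure_space_1 sets_eq_imp_space_eq[OF sets_D] by simp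
  ultimately have "(\<lambda>K. enn2real (emeasure D {..real K})) \<longlonglongrightarrow> 1"
    by (intro tendsto_enn2real) auto
  then show ?thesis by (simp add: measure_def)
qed

text \<open>Fatou's lemma along the truncation levels. The truncated cumulants can be negative, since truncation
  loses mass, but they are bounded below by the logarithm of the retained mass, which tends to zero. This
  covers points where the transform is infinite.\<close>
lemma cgf_integral_le_if_truncated:
  assumes pos: "0 \<le> c" "0 < \<mu>" "0 < t"
    and le: "\<And>K. K \<ge> K0 \<Longrightarrow> limit_cgf D {..real K} \<mu> t c \<le> z"
  shows "enn2ereal (cgf_integral D \<mu> t c) \<le> ereal z"
proof -
  let ?p = "\<lambda>K. measure D {..real K}"
  have "eventually (\<lambda>K. ?p K > 0) sequentially"
    using prob_atMost_tendsto by (rule order_tendstoD(1)) simp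
  then obtain K1 where K1: "\<And>K. K \<ge> K1 \<Longrightarrow> ?p K > 0" by (auto simp: eventually_sequentially)
  define Ks where "Ks = (\<lambda>n. n + K0 + K1)"
  let ?B = "\<lambda>n. {..real (Ks n)}"
  let ?f = "\<lambda>n s. restricted_cgf D (?B n) (c * exp (- \<mu> * s))"
  have p: "?p (Ks n) > 0" "emeasure D (?B n) > 0" for n
    using K1[of "Ks n"] by (auto simp: Ks_def emeasure_eq_measure)
  have Ks_lim: "filterlim Ks at_top sequentially"
    by (rule filterlim_subseq) (auto simp: Ks_def strict_mono_def)
  have lnp: "(\<lambda>n. z - t * ln (?p (Ks n))) \<longlonglongrightarrow> z - t * ln 1"
    by (intro tendsto_intros filterlim_compose[OF prob_atMost_tendsto Ks_lim]) simp
  have lnp0: "ln (?p K) \<le> 0" for K by (cases "?p K = 0") (auto simp: ln_le_zero_iff zero_less_measure_iff)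
  have fin: "restricted_mgf D (?B n) c < \<infinity>" for n by (rule restricted_mgf_atMost_finite[OF pos(1)])
  have ge: "ln (?p (Ks n)) \<le> ?f n s" if "s \<in> {0..t}" for n s
  proof -
    note y = mult_exp_decay_le[OF pos(1,2) that]
    show ?thesis by (rule restricted_cgf_ge_ln_prob[OF _ p(1) restricted_mgf_finite_le[OF fin y(2)] y(1)]) simp
  qed
  have lim: "(\<lambda>n. ennreal (?f n s)) \<longlonglongrightarrow> e2ennreal (elog (restricted_mgf D UNIV (c * exp (- \<mu> * s))))"
    if s: "s \<in> {0..t}" for s
  proof -
    define y where "y = c * exp (- \<mu> * s)"
    have y: "0 \<le> y" using mult_exp_decay_le[OF pos(1,2) s] by (simp add: y_def)
    have m: "(\<lambda>n. restricted_mgf D (?B n) y) \<longlonglongrightarrow> restricted_mgf D UNIV y"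
      by (rule filterlim_compose[OF restricted_mgf_atMost_tendsto Ks_lim])
    have nz: "restricted_mgf D UNIV y > 0" by (rule restricted_mgf_pos[OF _ emeasure_UNIV_pos y]) simp
    show ?thesis unfolding y_def[symmetric]
    proof (cases "restricted_mgf D UNIV y = \<top>")
      case True
      have "(\<lambda>n. ennreal (restricted_cgf D (?B n) y)) \<longlonglongrightarrow> \<top>"
        unfolding tendsto_top_iff_ennreal
      proof (intro allI impI)
        fix l :: real assume "0 \<le> l"
        have "eventually (\<lambda>n. ennreal (exp l) < restricted_mgf D (?B n) y) sequentially"
          using m True by (intro order_tendstoD(1)) auto
        then show "eventually (\<lambda>n. ennreal l < ennreal (restricted_cgf D (?B n) y)) sequentially"
        proof eventually_elim
          case (elim n)
          have "restricted_mgf D (?B n) y < \<infinity>" by (rule restricted_mgf_atMost_finite[OF y])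
          then have "exp l < enn2real (restricted_mgf D (?B n) y)"
            using elim by (cases "restricted_mgf D (?B n) y") (auto simp: ennreal_less_iff)
          then have "ln (exp l) < restricted_cgf D (?B n) y"
            unfolding restricted_cgf_def by (subst ln_less_cancel_iff) (auto intro: less_trans[OF exp_gt_zero])
          then show ?case using \<open>0 \<le> l\<close> by (simp add: ennreal_less_iff)
        qed
      qed
      then show "(\<lambda>n. ennreal (restricted_cgf D (?B n) y)) \<longlonglongrightarrow> e2ennreal (elog (restricted_mgf D UNIV y))"
        using True by (simp add: elog_def)
    next
      case False
      then have r: "restricted_mgf D UNIV y = ennreal (enn2real (restricted_mgf D UNIV y))" by (simp add: less_top)
      have "enn2real (restricted_mgf D UNIV y) > 0" using False nz by (simp add: enn2real_positive_iff less_top)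
      moreover have "(\<lambda>n. enn2real (restricted_mgf D (?B n) y)) \<longlonglongrightarrow> enn2real (restricted_mgf D UNIV y)"
        using m by (intro tendsto_enn2real) (auto simp: r[symmetric])
      ultimately have "(\<lambda>n. restricted_cgf D (?B n) y) \<longlonglongrightarrow> restricted_cgf D UNIV y"
        unfolding restricted_cgf_def by (intro tendsto_ln) auto
      then show "(\<lambda>n. ennreal (restricted_cgf D (?B n) y)) \<longlonglongrightarrow> e2ennreal (elog (restricted_mgf D UNIV y))"
        using False nz by (auto simp: elog_def restricted_cgf_def)
    qed
  qed
  have int: "(\<lambda>s. ?f n s) integrable_on {0..t}" for n
    by (rule cgf_profile_integrable[OF _ p(2) fin pos(1,2)]) simp
  have cont: "continuous_on {0..t} (?f n)" for n
    by (rule continuous_cgf_profile[OF _ p(2) fin pos(1,2)]) simp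
  have bound: "(\<integral>\<^sup>+s\<in>{0..t}. ennreal (?f n s) \<partial>lborel) \<le> ennreal (z - t * ln (?p (Ks n)))" for n
  proof -
    have "(\<integral>\<^sup>+s\<in>{0..t}. ennreal (?f n s) \<partial>lborel) \<le> (\<integral>\<^sup>+s\<in>{0..t}. ennreal (?f n s - ln (?p (Ks n))) \<partial>lborel)"
      by (intro nn_integral_mono mult_right_mono ennreal_leI) (use lnp0[of "Ks n"] in auto)
    also have "\<dots> = ennreal (integral {0..t} (\<lambda>s. ?f n s - ln (?p (Ks n))))"
      by (rule nn_integral_Icc_continuous) (use ge cont in \<open>auto intro!: continuous_intros\<close>)
    also have "integral {0..t} (\<lambda>s. ?f n s - ln (?p (Ks n))) = limit_cgf D (?B n) \<mu> t c - t * ln (?p (Ks n))"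
      using integral_diff[OF int integrable_const_ivl] pos(3) by (simp add: limit_cgf_def)
    also have "ennreal \<dots> \<le> ennreal (z - t * ln (?p (Ks n)))"
      using le[of "Ks n"] by (intro ennreal_leI) (simp add: Ks_def)
    finally show ?thesis .
  qed
  have "cgf_integral D \<mu> t c = (\<integral>\<^sup>+s. liminf (\<lambda>n. ennreal (?f n s) * indicator {0..t} s) \<partial>lborel)"
    unfolding cgf_integral_def
  proof (rule nn_integral_cong)
    fix s :: real
    show "e2ennreal (elog (restricted_mgf D UNIV (c * exp (- \<mu> * s)))) * indicator {0..t} s
      = liminf (\<lambda>n. ennreal (?f n s) * indicator {0..t} s)"
    proof (cases "s \<in> {0..t}")
      case True
      then show ?thesis using lim_imp_Liminf[OF sequentially_bot lim[OF True]] by simp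
    qed (simp add: Liminf_const)
  qed
  also have "\<dots> \<le> liminf (\<lambda>n. \<integral>\<^sup>+s\<in>{0..t}. ennreal (?f n s) \<partial>lborel)"
  proof (rule nn_integral_liminf)
    fix n
    have "(\<lambda>s. indicator {0..t} s *\<^sub>R ?f n s) \<in> borel_measurable lborel"
      using borel_integrable_atLeastAtMost'[OF cont[of n]] unfolding set_integrable_def by (rule borel_measurable_integrable)
    then have "(\<lambda>s. ennreal (indicator {0..t} s *\<^sub>R ?f n s)) \<in> borel_measurable lborel" by measurable
    moreover have "(\<lambda>s. ennreal (indicator {0..t} s *\<^sub>R ?f n s)) = (\<lambda>s. ennreal (?f n s) * indicator {0..t} s)"
      by (auto simp: indicator_def)
    ultimately show "(\<lambda>s. ennreal (?f n s) * indicator {0..t} s) \<in> borel_measurable lborel" by simp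
  qed
  also have "\<dots> \<le> liminf (\<lambda>n. ennreal (z - t * ln (?p (Ks n))))"
    by (intro Liminf_mono always_eventually allI bound)
  also have "\<dots> = ennreal z"
    by (rule lim_imp_Liminf[OF sequentially_bot]) (use tendsto_ennrealI[OF lnp] in simp)
  finally have L: "cgf_integral D \<mu> t c \<le> ennreal z" .
  have "t * ln (?p (Ks n)) \<le> z" for n
  proof -
    have "integral {0..t} (\<lambda>s. ln (?p (Ks n))) \<le> limit_cgf D (?B n) \<mu> t c"
      unfolding limit_cgf_def by (rule integral_le[OF integrable_const_ivl int ge])
    then show ?thesis using le[of "Ks n"] pos(3) by (simp add: Ks_def)
  qed
  then have "0 \<le> z - t * ln (?p (Ks n))" for n by simp
  then have "0 \<le> z" using LIMSEQ_le_const[OF lnp, of 0] by auto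
  then show ?thesis using L by (metis enn2ereal_ennreal less_eq_ennreal.rep_eq)
qed

end

section \<open>Coercivity and positivity of the rate\<close>

context positive_law
begin

text \<open>Put \<open>z = y x\<close>. From \<open>exp z \<le> 1 + z + z\<^sup>2 exp z\<close>, and since for \<open>y \<le> y0 / 2\<close> the quadratic factor \<open>x\<^sup>2\<close>
  is absorbed by the other half of the exponent, \<open>x\<^sup>2 \<le> (8 / y0\<^sup>2) exp (y0 x / 2)\<close>.\<close>
lemma mgf_near_zero:
  assumes int: "integrable D (\<lambda>x. x)" and y0: "0 < y0" "restricted_mgf D UNIV y0 < \<infinity>"
  shows "\<exists>C. \<forall>y. 0 \<le> y \<longrightarrow> y \<le> y0 / 2 \<longrightarrow> restricted_mgf D UNIV y < \<infinity>
    \<and> restricted_cgf D UNIV y \<le> y * expectation (\<lambda>x. x) + y\<^sup>2 * C"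
proof (intro exI[of _ "8 / y0\<^sup>2 * enn2real (restricted_mgf D UNIV y0)"] allI impI conjI)
  fix y assume y: "0 \<le> y" "y \<le> y0 / 2"
  let ?K = "8 / y0\<^sup>2"
  show fin: "restricted_mgf D UNIV y < \<infinity>" using y y0 by (intro restricted_mgf_finite_le[OF y0(2)]) simp
  have pw: "exp (y * x) \<le> 1 + y * x + y\<^sup>2 * (?K * exp (y0 * x))" if x: "x > 0" for x :: real
  proof -
    define z where "z = y * x"
    have z: "0 \<le> z" using x y by (simp add: z_def)
    have e1: "exp z - 1 \<le> z * exp z"
    proof -
      have "1 - z \<le> exp (- z)" using exp_ge_add_one_self[of "- z"] by simp
      then have "(1 - z) * exp z \<le> exp (- z) * exp z" by (rule mult_right_mono) simp
      then show ?thesis by (simp add: exp_minus algebra_simps)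
    qed
    have "z * (exp z - 1) \<le> z * (z * exp z)" by (rule mult_left_mono[OF e1 z])
    then have "exp z \<le> 1 + z + z\<^sup>2 * exp z" using e1 by (simp add: algebra_simps power2_eq_square)
    moreover have "x\<^sup>2 * exp z \<le> ?K * exp (y0 * x)"
    proof -
      define w where "w = y0 / 2 * x"
      have w: "0 \<le> w" using x y0 by (simp add: w_def)
      have "w\<^sup>2 / 2 \<le> exp w" using exp_lower_Taylor_quadratic[OF w] w by simp
      then have "x\<^sup>2 \<le> ?K * exp w" using y0 by (simp add: w_def power_mult_distrib power_divide field_simps)
      moreover have "exp z \<le> exp w" using y x by (simp add: z_def w_def)
      ultimately have "x\<^sup>2 * exp z \<le> ?K * exp w * exp w" by (intro mult_mono) auto
      also have "\<dots> = ?K * exp (y0 * x)" by (simp add: w_def exp_add[symmetric] mult.assoc)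
      finally show ?thesis .
    qed
    then have "y\<^sup>2 * (x\<^sup>2 * exp z) \<le> y\<^sup>2 * (?K * exp (y0 * x))" by (rule mult_left_mono) simp
    ultimately show ?thesis by (simp add: z_def power_mult_distrib mult.assoc)
  qed
  have fin0: "(\<integral>\<^sup>+x. ennreal (exp (y0 * x)) \<partial>D) < \<infinity>"
    using y0(2) by (simp add: restricted_mgf_def)
  have ie: "integrable D (\<lambda>x. exp (y0 * x))"
    using fin0 by (intro integrableI_nonneg) auto
  have Ee: "expectation (\<lambda>x. exp (y0 * x)) = enn2real (restricted_mgf D UNIV y0)"
    by (subst integral_eq_nn_integral) (auto simp: restricted_mgf_def)
  let ?r = "\<lambda>x. 1 + y * x + y\<^sup>2 * (?K * exp (y0 * x))"
  have ir: "integrable D ?r" using int ie by auto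
  have ge: "AE x in D. 0 \<le> ?r x"
    using positive by eventually_elim (use y in \<open>auto intro!: add_nonneg_nonneg mult_nonneg_nonneg\<close>)
  have "restricted_mgf D UNIV y \<le> (\<integral>\<^sup>+x. ennreal (?r x) \<partial>D)"
    unfolding restricted_mgf_def
    by (intro nn_integral_mono_AE, use positive in eventually_elim)
       (simp only: indicator_UNIV mult_1_right, intro ennreal_leI pw)
  also have "\<dots> = ennreal (expectation ?r)" by (rule nn_integral_eq_integral[OF ir ge])
  also have "expectation ?r = 1 + y * expectation (\<lambda>x. x) + y\<^sup>2 * (?K * enn2real (restricted_mgf D UNIV y0))"
    using int ie by (simp add: Ee prob_space)
  finally have le: "restricted_mgf D UNIV y \<le> ennreal (1 + y * expectation (\<lambda>x. x) + y\<^sup>2 * (?K * enn2real (restricted_mgf D UNIV y0)))" .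
  have pos: "0 < enn2real (restricted_mgf D UNIV y)"
    by (rule enn2real_restricted_mgf_pos[OF _ emeasure_UNIV_pos fin y(1)]) simp
  have E0: "0 \<le> expectation (\<lambda>x. x)"
    by (rule integral_nonneg_AE) (use positive in eventually_elim, simp)
  then have nn: "0 \<le> y * expectation (\<lambda>x. x) + y\<^sup>2 * (?K * enn2real (restricted_mgf D UNIV y0))" using y by simp
  have "enn2real (restricted_mgf D UNIV y) \<le> 1 + (y * expectation (\<lambda>x. x) + y\<^sup>2 * (?K * enn2real (restricted_mgf D UNIV y0)))"
    by (rule enn2real_leI) (use nn le in \<open>simp_all only: add.assoc add_nonneg_nonneg zero_le_one\<close>)
  then have "enn2real (restricted_mgf D UNIV y) \<le> exp (y * expectation (\<lambda>x. x) + y\<^sup>2 * (?K * enn2real (restricted_mgf D UNIV y0)))"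
    using exp_ge_add_one_self order_trans by blast
  then show "restricted_cgf D UNIV y \<le> y * expectation (\<lambda>x. x) + y\<^sup>2 * (?K * enn2real (restricted_mgf D UNIV y0))"
    unfolding restricted_cgf_def using pos by (subst exp_le_cancel_iff[symmetric]) (simp only: exp_ln)
qed

text \<open>The objective \<open>\<theta> a - L(\<theta>)\<close> of the variational problem vanishes at zero and is bounded below by a
  function whose derivative at zero is \<open>a - \<rho>(t) > 0\<close>. A level above the mean thus has a strictly positive rate.\<close>
lemma rate_positive_point:
  assumes int: "integrable D (\<lambda>x. x)" and y0: "0 < y0" "restricted_mgf D UNIV y0 < \<infinity>"
    and pos: "0 < \<mu>" "0 < t" "0 < \<Delta>"
    and a: "expectation (\<lambda>x. x) / \<mu> * (1 - exp (- \<mu> * t)) < a"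
  shows "\<exists>\<theta>>0. restricted_mgf D UNIV (tilt \<Delta> \<theta>) < \<infinity> \<and> 0 < \<theta> * a - limit_cgf D UNIV \<mu> t (tilt \<Delta> \<theta>)"
proof -
  let ?E = "expectation (\<lambda>x. x)"
  define \<rho> where "\<rho> = ?E / \<mu> * (1 - exp (- \<mu> * t))"
  obtain C where C: "\<And>y. 0 \<le> y \<Longrightarrow> y \<le> y0 / 2 \<Longrightarrow> restricted_mgf D UNIV y < \<infinity>"
    "\<And>y. 0 \<le> y \<Longrightarrow> y \<le> y0 / 2 \<Longrightarrow> restricted_cgf D UNIV y \<le> y * ?E + y\<^sup>2 * C"
    using mgf_near_zero[OF int y0] by blast
  have upper: "limit_cgf D UNIV \<mu> t c \<le> c * \<rho> + c\<^sup>2 * (\<bar>C\<bar> * t)" if c: "0 \<le> c" "c \<le> y0 / 2" for c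
  proof -
    have "((\<lambda>s. c * ?E * exp (- \<mu> * s) + c\<^sup>2 * \<bar>C\<bar>) has_integral
       (- c * ?E / \<mu> * exp (- \<mu> * t) + c\<^sup>2 * \<bar>C\<bar> * t) - (- c * ?E / \<mu> * exp (- \<mu> * 0) + c\<^sup>2 * \<bar>C\<bar> * 0)) {0..t}"
      by (rule fundamental_theorem_of_calculus)
         (use pos in \<open>auto intro!: derivative_eq_intros simp: has_real_derivative_iff_has_vector_derivative[symmetric]\<close>)
    also have "(- c * ?E / \<mu> * exp (- \<mu> * t) + c\<^sup>2 * \<bar>C\<bar> * t) - (- c * ?E / \<mu> * exp (- \<mu> * 0) + c\<^sup>2 * \<bar>C\<bar> * 0)
       = c * \<rho> + c\<^sup>2 * (\<bar>C\<bar> * t)" using pos by (simp add: \<rho>_def field_simps)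
    finally have I: "((\<lambda>s. c * ?E * exp (- \<mu> * s) + c\<^sup>2 * \<bar>C\<bar>) has_integral c * \<rho> + c\<^sup>2 * (\<bar>C\<bar> * t)) {0..t}" .
    show ?thesis unfolding limit_cgf_def integral_unique[OF I, symmetric]
    proof (rule integral_le)
      show "(\<lambda>s. restricted_cgf D UNIV (c * exp (- \<mu> * s))) integrable_on {0..t}"
        using C(1)[OF c] c pos emeasure_UNIV_pos by (intro cgf_profile_integrable) auto
      show "(\<lambda>s. c * ?E * exp (- \<mu> * s) + c\<^sup>2 * \<bar>C\<bar>) integrable_on {0..t}" using I by blast
      fix s assume s: "s \<in> {0..t}"
      note y = mult_exp_decay_le[OF c(1) pos(1) s]
      have "restricted_cgf D UNIV (c * exp (- \<mu> * s)) \<le> (c * exp (- \<mu> * s)) * ?E + (c * exp (- \<mu> * s))\<^sup>2 * C"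
        by (rule C(2)[OF y(1) order_trans[OF y(2) c(2)]])
      moreover have "(c * exp (- \<mu> * s))\<^sup>2 * C \<le> (c * exp (- \<mu> * s))\<^sup>2 * \<bar>C\<bar>"
        by (rule mult_left_mono[OF abs_ge_self]) simp
      moreover have "(c * exp (- \<mu> * s))\<^sup>2 * \<bar>C\<bar> \<le> c\<^sup>2 * \<bar>C\<bar>"
        by (rule mult_right_mono[OF power_mono[OF y(2,1)]]) simp
      moreover have "(c * exp (- \<mu> * s)) * expectation (\<lambda>x. x) = c * expectation (\<lambda>x. x) * exp (- \<mu> * s)"
        by simp
      ultimately show "restricted_cgf D UNIV (c * exp (- \<mu> * s)) \<le> c * ?E * exp (- \<mu> * s) + c\<^sup>2 * \<bar>C\<bar>"
        by linarith
    qed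
  qed
  let ?g = "\<lambda>\<theta>. \<theta> * a - (tilt \<Delta> \<theta> * \<rho> + (tilt \<Delta> \<theta>)\<^sup>2 * (\<bar>C\<bar> * t))"
  have "(?g has_real_derivative a - \<rho>) (at 0)"
    unfolding tilt_def using pos by (auto intro!: derivative_eq_intros)
  then obtain d where d: "d > 0" "\<And>h. 0 < h \<Longrightarrow> h < d \<Longrightarrow> ?g 0 < ?g (0 + h)"
    using DERIV_pos_inc_right[of ?g "a - \<rho>" 0] a by (auto simp: \<rho>_def)
  have "((\<lambda>\<theta>. \<Delta> * (exp (\<theta> / \<Delta>) - 1)) \<longlongrightarrow> \<Delta> * (exp (0 / \<Delta>) - 1)) (at_right 0)"
    by (intro tendsto_intros) (use pos in simp)
  then have "(tilt \<Delta> \<longlongrightarrow> 0) (at_right 0)" by (simp add: tilt_def[abs_def])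
  then have "eventually (\<lambda>\<theta>. tilt \<Delta> \<theta> < y0 / 2) (at_right 0)"
    by (rule order_tendstoD(2)) (use y0 in simp)
  moreover have "eventually (\<lambda>\<theta>. \<theta> < d) (at_right 0)" "eventually (\<lambda>\<theta>::real. 0 < \<theta>) (at_right 0)"
    using d(1) by (auto intro: eventually_at_right_less order_tendstoD(2)[OF tendsto_ident_at])
  ultimately have "eventually (\<lambda>\<theta>. tilt \<Delta> \<theta> < y0 / 2 \<and> \<theta> < d \<and> 0 < \<theta>) (at_right 0)"
    by eventually_elim simp
  then obtain \<theta> where \<theta>: "tilt \<Delta> \<theta> < y0 / 2" "\<theta> < d" "0 < \<theta>"
    using eventually_happens'[OF trivial_limit_at_right_real] by blast
  have "0 \<le> tilt \<Delta> \<theta>" using \<theta> pos by (simp add: tilt_def)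
  then have "0 < \<theta> * a - limit_cgf D UNIV \<mu> t (tilt \<Delta> \<theta>)" "restricted_mgf D UNIV (tilt \<Delta> \<theta>) < \<infinity>"
    using upper[of "tilt \<Delta> \<theta>"] C(1)[of "tilt \<Delta> \<theta>"] d(2)[of \<theta>] \<theta> by (auto simp: tilt_def)
  then show ?thesis using \<theta>(3) by blast
qed

lemma interval_with_mass: "\<exists>n::nat. measure D {1 / (real n + 1)..real n} > 0"
proof (rule ccontr)
  assume "\<not> ?thesis"
  then have "emeasure D {1 / (real n + 1)..real n} = 0" for n
    by (auto simp: emeasure_eq_measure zero_less_measure_iff)
  then have "(\<Union>n. {1 / (real n + 1)..real n}) \<in> null_sets D"
    by (intro null_sets_UN) (auto simp: null_sets_def sets_D)
  then have "AE x in D. x \<notin> (\<Union>n. {1 / (real n + 1)..real n})" by (rule AE_not_in)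
  then have "AE x in D. False" using positive
  proof eventually_elim
    case (elim x)
    obtain n1 n2 where n: "x \<le> real n1" "1 / x \<le> real n2" using real_arch_simple by meson
    define n where "n = max n1 n2"
    have "x \<le> real n" "1 / x \<le> real n + 1" using n by (auto simp: n_def)
    then have "x \<in> {1 / (real n + 1)..real n}" using elim(2) by (auto simp: field_simps)
    then show ?case using elim(1) by blast
  qed
  then show False by simp
qed

text \<open>Uniformly over the high truncation levels, a value of the objective of at least \<open>\<delta> > 0\<close> confines \<open>\<theta>\<close>
  to a compact subinterval of the positive half-line; maximisers and accumulation points come from here. Near zero the
  linear term is too small, as the truncated cumulant is at least \<open>- \<delta> / 2\<close> for large levels; for large
  \<open>\<theta>\<close> the cumulant grows at least quadratically.\<close>
lemma truncated_level_sets_bounded: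
  assumes "0 < \<delta>" and pos: "0 < \<mu>" "0 < t" "0 < \<Delta>"
  obtains K0 lo hi where "0 < lo" "measure D {..real K0} > 0"
    "\<And>K \<theta>. K \<ge> K0 \<Longrightarrow> 0 < \<theta> \<Longrightarrow> \<delta> \<le> \<theta> * b - limit_cgf D {..real K} \<mu> t (tilt \<Delta> \<theta>) \<Longrightarrow> \<theta> \<in> {lo..hi}"
proof -
  obtain n where n: "measure D {1 / (real n + 1)..real n} > 0" using interval_with_mass by blast
  define S where "S = {1 / (real n + 1)..real n}"
  define q where "q = measure D S"
  have "(\<lambda>K. t * ln (measure D {..real K})) \<longlonglongrightarrow> t * ln 1"
    by (intro tendsto_intros prob_atMost_tendsto) simp
  then have "eventually (\<lambda>K. - \<delta> / 2 < t * ln (measure D {..real K})) sequentially"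
    by (rule order_tendstoD(1)) (use \<open>0 < \<delta>\<close> in simp)
  moreover have "eventually (\<lambda>K. 0 < measure D {..real K}) sequentially"
    using prob_atMost_tendsto by (rule order_tendstoD(1)) simp
  ultimately have "eventually (\<lambda>K. - \<delta> / 2 < t * ln (measure D {..real K}) \<and> 0 < measure D {..real K}) sequentially"
    by eventually_elim simp
  then obtain K1 where K1: "\<And>K. K \<ge> K1 \<Longrightarrow> - \<delta> / 2 < t * ln (measure D {..real K})" "\<And>K. K \<ge> K1 \<Longrightarrow> 0 < measure D {..real K}"
    unfolding eventually_sequentially by blast
  define K0 where "K0 = max K1 n"
  define \<beta> where "\<beta> = \<bar>b\<bar> + 1"
  define k where "k = t * (1 / (real n + 1)) * exp (- \<mu> * t) / (2 * \<Delta>)"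
  have k: "k > 0" using pos by (simp add: k_def)
  define lo where "lo = \<delta> / 2 / \<beta>"
  define hi where "hi = max 1 ((\<beta> + t * \<bar>ln q\<bar>) / k)"
  have \<beta>: "\<beta> > 0" "b \<le> \<beta>" by (auto simp: \<beta>_def)
  have "\<theta> \<in> {lo..hi}" if K: "K \<ge> K0" and \<theta>: "0 < \<theta>"
    and lev: "\<delta> \<le> \<theta> * b - limit_cgf D {..real K} \<mu> t (tilt \<Delta> \<theta>)" for K \<theta>
  proof -
    have c: "0 \<le> tilt \<Delta> \<theta>" using \<theta> pos by (simp add: tilt_def)
    have fin: "restricted_mgf D {..real K} (tilt \<Delta> \<theta>) < \<infinity>" by (rule restricted_mgf_atMost_finite[OF c])
    have KK: "K \<ge> K1" "K \<ge> n" using K by (auto simp: K0_def)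
    have "\<theta> * b \<le> \<theta> * \<beta>" using \<theta> \<beta> by simp
    then have lev': "limit_cgf D {..real K} \<mu> t (tilt \<Delta> \<theta>) + \<delta> \<le> \<theta> * \<beta>" using lev by linarith
    have Kp: "0 < emeasure D {..real K}" using K1(2)[OF KK(1)] by (simp add: emeasure_eq_measure)
    have "integral {0..t} (\<lambda>s. ln (measure D {..real K})) \<le> limit_cgf D {..real K} \<mu> t (tilt \<Delta> \<theta>)"
      unfolding limit_cgf_def
    proof (rule integral_le)
      fix s assume s: "s \<in> {0..t}"
      show "ln (measure D {..real K}) \<le> restricted_cgf D {..real K} (tilt \<Delta> \<theta> * exp (- \<mu> * s))"
        by (intro restricted_cgf_ge_ln_prob K1(2) KK restricted_mgf_finite_le[OF fin]
              mult_exp_decay_le[OF c pos(1) s]) simp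
    qed (intro integrable_const_ivl cgf_profile_integrable fin c pos Kp borel_closed closed_atMost)+
    then have "t * ln (measure D {..real K}) \<le> limit_cgf D {..real K} \<mu> t (tilt \<Delta> \<theta>)" using pos by simp
    then have "\<delta> / 2 \<le> \<theta> * \<beta>" using K1(1)[OF KK(1)] lev' by linarith
    then have "lo \<le> \<theta>" using \<beta> by (simp add: lo_def field_simps)
    moreover have "\<theta> \<le> hi"
    proof (cases "\<theta> \<le> 1")
      case False
      have "t * (ln (measure D S) + 1 / (real n + 1) * (tilt \<Delta> \<theta> * exp (- \<mu> * t))) \<le> limit_cgf D {..real K} \<mu> t (tilt \<Delta> \<theta>)"
        by (rule limit_cgf_ge) (use n KK fin c pos in \<open>auto simp: S_def\<close>)
      moreover have "k * \<theta>\<^sup>2 \<le> t * (1 / (real n + 1) * (tilt \<Delta> \<theta> * exp (- \<mu> * t)))"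
      proof -
        have "(\<theta> / \<Delta>)\<^sup>2 / 2 \<le> exp (\<theta> / \<Delta>) - 1"
          using exp_lower_Taylor_quadratic[of "\<theta> / \<Delta>"] \<theta> pos by (smt (verit) divide_pos_pos)
        then have "\<Delta> * ((\<theta> / \<Delta>)\<^sup>2 / 2) \<le> tilt \<Delta> \<theta>" unfolding tilt_def using pos by (intro mult_left_mono) auto
        then have t2: "\<theta>\<^sup>2 / (2 * \<Delta>) \<le> tilt \<Delta> \<theta>" using pos by (simp add: power_divide power2_eq_square)
        have "k * \<theta>\<^sup>2 = t * (1 / (real n + 1)) * exp (- \<mu> * t) * (\<theta>\<^sup>2 / (2 * \<Delta>))"
          by (simp add: k_def)
        also have "\<dots> \<le> t * (1 / (real n + 1)) * exp (- \<mu> * t) * tilt \<Delta> \<theta>"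
          using t2 pos by (intro mult_left_mono) auto
        finally show ?thesis by (simp add: mult_ac)
      qed
      ultimately have "t * ln q + k * \<theta>\<^sup>2 \<le> \<theta> * \<beta>"
        using lev' \<open>0 < \<delta>\<close> unfolding q_def distrib_left by linarith
      moreover have "- (t * ln q) \<le> \<theta> * (t * \<bar>ln q\<bar>)"
      proof -
        have "- (t * ln q) \<le> 1 * (t * \<bar>ln q\<bar>)" using pos mult_left_mono[of "- ln q" "\<bar>ln q\<bar>" t] by simp
        also have "\<dots> \<le> \<theta> * (t * \<bar>ln q\<bar>)" using False pos by (intro mult_right_mono) auto
        finally show ?thesis .
      qed
      ultimately have "\<theta> * (k * \<theta>) \<le> \<theta> * (\<beta> + t * \<bar>ln q\<bar>)" by (simp add: algebra_simps power2_eq_square)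
      then have "k * \<theta> \<le> \<beta> + t * \<bar>ln q\<bar>" using \<theta> by simp
      then have "\<theta> \<le> (\<beta> + t * \<bar>ln q\<bar>) / k" using k by (simp add: pos_le_divide_eq mult.commute)
      then show ?thesis by (simp add: hi_def)
    qed (simp add: hi_def)
    ultimately show ?thesis by simp
  qed
  moreover have "0 < lo" using \<beta> \<open>0 < \<delta>\<close> by (simp add: lo_def)
  moreover have "measure D {..real K0} > 0" using K1(2)[of K0] by (simp add: K0_def)
  ultimately show ?thesis using that by blast
qed

end

section \<open>Optimal tilts and removal of the truncation\<close>

context positive_law
begin

text \<open>A maximiser of the objective over the positive half-line exists by compactness, and there the
  derivative of the objective vanishes. The assumed value at \<open>\<theta>0\<close> ensures that the maximum over
  \<open>[lo, hi]\<close> is a maximum over all positive tilts.\<close>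
lemma truncated_optimal_tilt:
  assumes pos: "0 < \<mu>" "0 < t" "0 < \<Delta>" and K: "measure D {..K} > 0"
    and "0 < lo" and bounded: "\<And>\<theta>. 0 < \<theta> \<Longrightarrow> \<delta> \<le> \<theta> * b - limit_cgf D {..K} \<mu> t (tilt \<Delta> \<theta>) \<Longrightarrow> \<theta> \<in> {lo..hi}"
    and \<theta>0: "0 < \<theta>0" "\<delta> \<le> \<theta>0 * b - limit_cgf D {..K} \<mu> t (tilt \<Delta> \<theta>0)"
  shows "\<exists>\<theta>>0. ((\<lambda>\<eta>. limit_cgf D {..K} \<mu> t (tilt \<Delta> \<eta>)) has_real_derivative b) (at \<theta>)"
proof -
  let ?G = "\<lambda>\<eta>. limit_cgf D {..K} \<mu> t (tilt \<Delta> \<eta>)"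
  let ?F = "\<lambda>\<eta>. \<eta> * b - ?G \<eta>"
  have Kp: "emeasure D {..K} > 0" using K by (simp add: emeasure_eq_measure)
  have diff: "\<exists>d. (?G has_real_derivative d) (at \<theta>)" if "0 < \<theta>" for \<theta>
    by (rule limit_cgf_tilt_differentiable[OF _ Kp restricted_mgf_atMost_finite pos that]) simp_all
  have cont: "continuous_on {lo..hi} ?F"
  proof (intro continuous_intros)
    show "continuous_on {lo..hi} ?G"
      using diff \<open>0 < lo\<close> by (intro continuous_at_imp_continuous_on ballI) (meson DERIV_isCont atLeastAtMost_iff less_le_trans)
  qed
  have "\<theta>0 \<in> {lo..hi}" by (rule bounded[OF \<theta>0])
  then obtain \<theta> where \<theta>: "\<theta> \<in> {lo..hi}" "\<And>\<eta>. \<eta> \<in> {lo..hi} \<Longrightarrow> ?F \<eta> \<le> ?F \<theta>"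
    using continuous_attains_sup[OF compact_Icc _ cont] by auto
  have \<theta>pos: "0 < \<theta>" using \<theta>(1) \<open>0 < lo\<close> by simp
  have max: "?F \<eta> \<le> ?F \<theta>" if "0 < \<eta>" for \<eta>
  proof (cases "\<eta> \<in> {lo..hi}")
    case False
    then have "?F \<eta> < \<delta>" using bounded[OF that] by fastforce
    also have "\<delta> \<le> ?F \<theta>" using \<theta>0(2) \<theta>(2)[OF \<open>\<theta>0 \<in> {lo..hi}\<close>] by linarith
    finally show ?thesis by simp
  qed (rule \<theta>(2))
  obtain d where d: "(?G has_real_derivative d) (at \<theta>)" using diff[OF \<theta>pos] by blast
  then have "(?F has_real_derivative b - d) (at \<theta>)" by (auto intro!: derivative_eq_intros)
  then have "b - d = 0" by (rule DERIV_local_max[OF _ \<theta>pos]) (auto intro!: max)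
  then show ?thesis using d \<theta>pos by auto
qed

text \<open>Truncation and the slack in \<open>a\<close> are removed together. If at all high levels some tilt had an objective
  above \<open>b\<close>, these tilts would accumulate at some \<open>\<theta>' > 0\<close>. The objectives decrease with the level,
  so every one of them would be at least \<open>b\<close> at \<open>\<theta>'\<close>, and by Fatou's lemma so would the untruncated
  one.\<close>
lemma truncated_rate_le:
  assumes pos: "0 < \<mu>" "0 < t" "0 < \<Delta>" and "0 < b"
    and rate: "\<And>\<theta>. 0 < \<theta> \<Longrightarrow> ereal (\<theta> * a) - enn2ereal (cgf_integral D \<mu> t (tilt \<Delta> \<theta>)) < ereal b"
  shows "\<exists>K\<ge>K1. \<forall>\<theta>>0. \<theta> * (a + 2 / (real K + 1)) - limit_cgf D {..real K} \<mu> t (tilt \<Delta> \<theta>) \<le> b"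
proof (rule ccontr)
  assume neg: "\<not> ?thesis"
  let ?G = "\<lambda>K \<theta>. limit_cgf D {..real K} \<mu> t (tilt \<Delta> \<theta>)"
  obtain K0 lo hi where lo: "0 < lo" and K0: "measure D {..real K0} > 0"
    and bounded: "\<And>K \<theta>. K \<ge> K0 \<Longrightarrow> 0 < \<theta> \<Longrightarrow> b \<le> \<theta> * (a + 2) - ?G K \<theta> \<Longrightarrow> \<theta> \<in> {lo..hi}"
    by (rule truncated_level_sets_bounded[OF \<open>0 < b\<close> pos, of "a + 2"]) (rule that, assumption, assumption, blast)
  define k where "k = (\<lambda>n. n + K0 + K1)"
  have kp: "emeasure D {..real K} > 0" if "K \<ge> K0" for K
    using K0 finite_measure_mono[of "{..real K0}" "{..real K}"] that by (auto simp: emeasure_eq_measure sets_D)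
  have exceeds: "\<exists>\<theta>>0. b < \<theta> * (a + 2 / (real K + 1)) - ?G K \<theta>" if "K \<ge> K1" for K
    using neg that by (meson not_le)
  have "\<forall>n. \<exists>\<theta>>0. b < \<theta> * (a + 2 / (real (k n) + 1)) - ?G (k n) \<theta>"
    by (intro allI exceeds) (simp add: k_def)
  then obtain \<theta> where \<theta>: "\<And>n. 0 < \<theta> n" "\<And>n. b < \<theta> n * (a + 2 / (real (k n) + 1)) - ?G (k n) (\<theta> n)"
    by metis
  have "\<theta> n \<in> {lo..hi}" for n
  proof (rule bounded)
    show "K0 \<le> k n" by (simp add: k_def)
    have "\<theta> n * (a + 2 / (real (k n) + 1)) \<le> \<theta> n * (a + 2)"
      using \<theta>(1)[of n] by (intro mult_left_mono) (auto simp: field_simps)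
    then show "b \<le> \<theta> n * (a + 2) - ?G (k n) (\<theta> n)" using \<theta>(2)[of n] by linarith
  qed (rule \<theta>(1))
  then obtain \<theta>' r where \<theta>': "\<theta>' \<in> {lo..hi}" "strict_mono (r :: nat \<Rightarrow> nat)" "(\<theta> \<circ> r) \<longlonglongrightarrow> \<theta>'"
    using seq_compactE[OF compact_imp_seq_compact[OF compact_Icc], of \<theta> lo hi] by metis
  have \<theta>'pos: "0 < \<theta>'" using \<theta>'(1) lo by simp
  have tp: "0 \<le> tilt \<Delta> \<eta>" if "0 < \<eta>" for \<eta> using that pos by (simp add: tilt_def)
  have mono: "?G K \<eta> \<le> ?G K' \<eta>" if "K0 \<le> K" "K \<le> K'" "0 < \<eta>" for K K' \<eta>
    by (rule limit_cgf_mono[OF _ kp[OF that(1)] _ restricted_mgf_atMost_finite[OF tp[OF that(3)]] tp[OF that(3)] pos(1)])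
       (use that in auto)
  have limit: "?G K \<theta>' \<le> \<theta>' * (a + 2 / (real K + 1)) - b" if K: "K0 \<le> K" for K
  proof -
    have "\<exists>d. (?G K has_real_derivative d) (at \<theta>')"
      by (rule limit_cgf_tilt_differentiable[OF _ kp[OF K] restricted_mgf_atMost_finite pos \<theta>'pos]) simp_all
    then have "isCont (?G K) \<theta>'" using DERIV_isCont by blast
    then have lim: "(\<lambda>n. (\<theta> \<circ> r) n * (a + 2 / (real K + 1)) - ?G K ((\<theta> \<circ> r) n)) \<longlonglongrightarrow> \<theta>' * (a + 2 / (real K + 1)) - ?G K \<theta>'"
      by (intro tendsto_intros \<theta>'(3) isCont_tendsto_compose[of _ "?G K"])
    have "b \<le> (\<theta> \<circ> r) n * (a + 2 / (real K + 1)) - ?G K ((\<theta> \<circ> r) n)" if n: "n \<ge> K" for n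
    proof -
      have "K \<le> k (r n)" using n seq_suble[OF \<theta>'(2), of n] by (simp add: k_def)
      then have "?G K (\<theta> (r n)) \<le> ?G (k (r n)) (\<theta> (r n))" by (rule mono[OF K _ \<theta>(1)])
      moreover have "\<theta> (r n) * (a + 2 / (real (k (r n)) + 1)) \<le> \<theta> (r n) * (a + 2 / (real K + 1))"
        using \<open>K \<le> k (r n)\<close> \<theta>(1)[of "r n"] by (intro mult_left_mono add_left_mono divide_left_mono) auto
      ultimately show ?thesis using \<theta>(2)[of "r n"] by simp
    qed
    then have "b \<le> \<theta>' * (a + 2 / (real K + 1)) - ?G K \<theta>'"
      by (intro LIMSEQ_le_const[OF lim]) blast
    then show ?thesis by linarith
  qed
  have "?G K \<theta>' \<le> \<theta>' * a - b" if K: "K0 \<le> K" for K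
  proof -
    have "(\<lambda>K'. 2 / (real K' + 1)) \<longlonglongrightarrow> 0"
      using LIMSEQ_ignore_initial_segment[OF lim_const_over_n[of "2 :: real"], of 1] by (simp add: add.commute)
    then have lim: "(\<lambda>K'. \<theta>' * (a + 2 / (real K' + 1)) - b) \<longlonglongrightarrow> \<theta>' * (a + 0) - b"
      by (intro tendsto_intros)
    have "?G K \<theta>' \<le> \<theta>' * (a + 2 / (real K' + 1)) - b" if "K' \<ge> K" for K'
      using mono[OF K that \<theta>'pos] limit[of K'] K that by linarith
    then show ?thesis using LIMSEQ_le_const[OF lim] by auto
  qed
  then have "enn2ereal (cgf_integral D \<mu> t (tilt \<Delta> \<theta>')) \<le> ereal (\<theta>' * a - b)"
    by (rule cgf_integral_le_if_truncated[OF tp[OF \<theta>'pos] pos(1,2)])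
  then have "ereal (\<theta>' * a) - ereal (\<theta>' * a - b) \<le> ereal (\<theta>' * a) - enn2ereal (cgf_integral D \<mu> t (tilt \<Delta> \<theta>'))"
    by (rule ereal_minus_mono[OF order_refl])
  then show False using rate[OF \<theta>'pos] by simp
qed

end

section \<open>The logarithmic tail asymptotics\<close>

context queue_model
begin

interpretation D: positive_law D by (rule law)

text \<open>The exponential bound is applied slightly to the left of \<open>\<theta>\<close>: there the transform is finite, even if it
  is infinite at \<open>\<theta>\<close> itself while its logarithm is integrable. The cumulant integral increases with
  \<open>\<theta>\<close>, so this costs only \<open>(\<theta> - \<theta>') a\<close>.\<close>
lemma limsup_scaled_log_tail:
  "limsup (scaled_log_tail a) \<le> - (SUP \<theta>\<in>{0<..}. ereal (\<theta> * a) - enn2ereal (cgf_integral D \<mu> t (tilt \<Delta> \<theta>)))"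
proof -
  let ?L = "\<lambda>\<theta>. cgf_integral D \<mu> t (tilt \<Delta> \<theta>)"
  have "ereal (\<theta> * a) - enn2ereal (?L \<theta>) \<le> - limsup (scaled_log_tail a)" if \<theta>: "\<theta> > 0" for \<theta>
  proof (cases "?L \<theta> = \<top>")
    case False
    then obtain l where l: "?L \<theta> = ennreal l" "0 \<le> l" by (cases "?L \<theta>") auto
    have "limsup (scaled_log_tail a) \<le> ereal (l - \<theta> * a) + ereal e" if e: "0 < e" for e
    proof -
      define \<theta>' where "\<theta>' = max (\<theta> / 2) (\<theta> - e / (\<bar>a\<bar> + 1))"
      have \<theta>': "0 < \<theta>'" "\<theta>' < \<theta>" "\<theta> - \<theta>' \<le> e / (\<bar>a\<bar> + 1)" using \<theta> e by (auto simp: \<theta>'_def)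
      have lt: "tilt \<Delta> \<theta>' < tilt \<Delta> \<theta>" using \<theta>' \<Delta>_pos by (simp add: tilt_def divide_strict_right_mono)
      have t0: "0 < tilt \<Delta> \<theta>'" by (rule tilt_pos[OF \<theta>'(1)])
      have fin: "restricted_mgf D UNIV (tilt \<Delta> \<theta>') < \<infinity>"
        by (rule D.mgf_finite_if_cgf_integral_finite[OF _ t0 lt \<mu>_pos t_pos]) (simp add: l(1))
      have "ennreal (limit_cgf D UNIV \<mu> t (tilt \<Delta> \<theta>')) \<le> ennreal l"
        using D.cgf_integral_mono[of "tilt \<Delta> \<theta>'" "tilt \<Delta> \<theta>" \<mu> t] t0 lt
        by (simp add: D.cgf_integral_finite(1)[OF fin _ \<mu>_pos] l(1))
      then have le: "limit_cgf D UNIV \<mu> t (tilt \<Delta> \<theta>') \<le> l" using l(2) by simp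
      have "(\<theta> - \<theta>') * a \<le> (\<theta> - \<theta>') * (\<bar>a\<bar> + 1)" using \<theta>' by (intro mult_left_mono) auto
      also have "\<dots> \<le> e / (\<bar>a\<bar> + 1) * (\<bar>a\<bar> + 1)" using \<theta>'(3) by (intro mult_right_mono) auto
      also have "\<dots> = e" by simp
      finally have "limit_cgf D UNIV \<mu> t (tilt \<Delta> \<theta>') - \<theta>' * a \<le> l - \<theta> * a + e" using le by (simp add: algebra_simps)
      then show ?thesis using queue_tail_upper[OF \<theta>'(1) fin, of a]
        by (auto intro: order_trans)
    qed
    then have "limsup (scaled_log_tail a) \<le> ereal (l - \<theta> * a)" by (rule ereal_le_epsilon2)
    then have "- ereal (l - \<theta> * a) \<le> - limsup (scaled_log_tail a)" by (simp only: ereal_minus_le_minus)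
    then show ?thesis using l by simp
  qed simp
  then have "(SUP \<theta>\<in>{0<..}. ereal (\<theta> * a) - enn2ereal (?L \<theta>)) \<le> - limsup (scaled_log_tail a)"
    by (intro SUP_least) simp
  then have "- (- limsup (scaled_log_tail a)) \<le> - (SUP \<theta>\<in>{0<..}. ereal (\<theta> * a) - enn2ereal (?L \<theta>))"
    by (simp only: ereal_minus_le_minus)
  then show ?thesis by (simp only: ereal_uminus_uminus)
qed

text \<open>For every \<open>b\<close> above the rate, one truncation level \<open>K\<close> and a slack \<open>\<epsilon> = 1 / (K + 1)\<close> serve both
  purposes: the truncated objective with slack \<open>2 \<epsilon>\<close> stays below \<open>b\<close>, and the one with slack \<open>\<epsilon>\<close>
  has an interior maximiser, whose tilt yields the lower bound.\<close>
lemma liminf_scaled_log_tail: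
  assumes int: "integrable D (\<lambda>x. x)" and y0: "0 < y0" "restricted_mgf D UNIV y0 < \<infinity>"
    and a: "D.expectation (\<lambda>x. x) / \<mu> * (1 - exp (- \<mu> * t)) < a"
  shows "- (SUP \<theta>\<in>{0<..}. ereal (\<theta> * a) - enn2ereal (cgf_integral D \<mu> t (tilt \<Delta> \<theta>))) \<le> liminf (scaled_log_tail a)"
    (is "- ?I \<le> _")
proof -
  obtain \<theta>0 where \<theta>0: "0 < \<theta>0" and fin0: "restricted_mgf D UNIV (tilt \<Delta> \<theta>0) < \<infinity>"
    and "0 < \<theta>0 * a - limit_cgf D UNIV \<mu> t (tilt \<Delta> \<theta>0)"
    using D.rate_positive_point[OF int y0 \<mu>_pos t_pos \<Delta>_pos a] by blast
  moreover define \<delta> where "\<delta> = \<theta>0 * a - limit_cgf D UNIV \<mu> t (tilt \<Delta> \<theta>0)"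
  ultimately have \<delta>: "0 < \<delta>" by simp
  have t0: "0 \<le> tilt \<Delta> \<theta>0" using tilt_pos[OF \<theta>0] by simp
  have below: "ereal (- b) \<le> liminf (scaled_log_tail a)" if b: "?I < ereal b" for b
  proof -
    have rate: "ereal (\<theta> * a) - enn2ereal (cgf_integral D \<mu> t (tilt \<Delta> \<theta>)) < ereal b" if "0 < \<theta>" for \<theta>
      by (rule le_less_trans[OF SUP_upper b]) (use that in simp)
    have "\<delta> < b"
      using rate[OF \<theta>0] D.cgf_integral_finite[OF fin0 t0 \<mu>_pos, of t] by (simp add: \<delta>_def)
    then have "0 < b" using \<delta> by simp
    obtain K0 lo hi where lo: "0 < lo" and K0: "measure D {..real K0} > 0"
      and bounded: "\<And>K \<theta>. K \<ge> K0 \<Longrightarrow> 0 < \<theta> \<Longrightarrow>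
        \<delta> \<le> \<theta> * (a + 2) - limit_cgf D {..real K} \<mu> t (tilt \<Delta> \<theta>) \<Longrightarrow> \<theta> \<in> {lo..hi}"
      by (rule D.truncated_level_sets_bounded[OF \<delta> \<mu>_pos t_pos \<Delta>_pos, of "a + 2"]) (rule that, assumption, assumption, blast)
    obtain K where K: "K \<ge> K0"
      and le_b: "\<And>\<theta>. \<theta> > 0 \<Longrightarrow> \<theta> * (a + 2 / (real K + 1)) - limit_cgf D {..real K} \<mu> t (tilt \<Delta> \<theta>) \<le> b"
      using D.truncated_rate_le[OF \<mu>_pos t_pos \<Delta>_pos \<open>0 < b\<close> rate, of K0] by blast
    define \<epsilon> where "\<epsilon> = 1 / (real K + 1)"
    have \<epsilon>: "0 < \<epsilon>" "\<epsilon> \<le> 2" "2 / (real K + 1) = 2 * \<epsilon>" by (auto simp: \<epsilon>_def field_simps)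
    have Kp: "measure D {..real K} > 0" 
      using K0 D.finite_measure_mono[of "{..real K0}" "{..real K}"] K by (auto simp: D.sets_D)
    then have Kp': "emeasure D {..real K} > 0" by (simp add: D.emeasure_eq_measure)
    have "\<exists>\<theta>>0. ((\<lambda>\<eta>. limit_cgf D {..real K} \<mu> t (tilt \<Delta> \<eta>)) has_real_derivative a + \<epsilon>) (at \<theta>)"
    proof (rule D.truncated_optimal_tilt[OF \<mu>_pos t_pos \<Delta>_pos Kp lo _ \<theta>0])
      fix \<theta> :: real assume \<theta>: "0 < \<theta>" "\<delta> \<le> \<theta> * (a + \<epsilon>) - limit_cgf D {..real K} \<mu> t (tilt \<Delta> \<theta>)"
      have "\<theta> * (a + \<epsilon>) \<le> \<theta> * (a + 2)" using \<theta>(1) \<epsilon>(2) by simp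
      then have "\<delta> \<le> \<theta> * (a + 2) - limit_cgf D {..real K} \<mu> t (tilt \<Delta> \<theta>)" using \<theta>(2) by linarith
      then show "\<theta> \<in> {lo..hi}" by (rule bounded[OF K \<theta>(1)])
    next
      have "limit_cgf D {..real K} \<mu> t (tilt \<Delta> \<theta>0) \<le> limit_cgf D UNIV \<mu> t (tilt \<Delta> \<theta>0)"
        by (rule D.limit_cgf_mono[OF _ Kp' _ fin0 t0 \<mu>_pos]) auto
      moreover have "\<theta>0 * a \<le> \<theta>0 * (a + \<epsilon>)" using \<theta>0 \<epsilon>(1) by simp
      ultimately show "\<delta> \<le> \<theta>0 * (a + \<epsilon>) - limit_cgf D {..real K} \<mu> t (tilt \<Delta> \<theta>0)" by (simp add: \<delta>_def)
    qed
    then obtain \<theta> where \<theta>: "\<theta> > 0"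
      and deriv: "((\<lambda>\<eta>. limit_cgf D {..real K} \<mu> t (tilt \<Delta> \<eta>)) has_real_derivative a + \<epsilon>) (at \<theta>)" by blast
    have "ereal (- b) \<le> ereal (limit_cgf D {..real K} \<mu> t (tilt \<Delta> \<theta>) - \<theta> * (a + 2 * \<epsilon>))"
      using le_b[OF \<theta>] \<epsilon>(3) by simp
    also have "\<dots> \<le> liminf (scaled_log_tail a)"
      by (rule queue_tail_lower[OF _ Kp' D.restricted_mgf_atMost_finite \<theta> \<epsilon>(1) deriv]) simp_all
    finally show ?thesis .
  qed
  show ?thesis
  proof (rule ccontr)
    assume "\<not> ?thesis"
    then have "liminf (scaled_log_tail a) < - ?I" by simp
    then obtain z where z: "liminf (scaled_log_tail a) < ereal z" "ereal z < - ?I" using ereal_dense2 by blast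
    have "?I < ereal (- z)" using z(2) by (metis ereal_less_uminus_reorder uminus_ereal.simps(1))
    from below[OF this] z(1) show False by simp
  qed
qed

theorem scaled_log_tail_tendsto:
  assumes "integrable D (\<lambda>x. x)" "0 < y0" "restricted_mgf D UNIV y0 < \<infinity>"
    and "D.expectation (\<lambda>x. x) / \<mu> * (1 - exp (- \<mu> * t)) < a"
  shows "scaled_log_tail a \<longlonglongrightarrow>
    - (SUP \<theta>\<in>{0<..}. ereal (\<theta> * a) - enn2ereal (cgf_integral D \<mu> t (tilt \<Delta> \<theta>)))"
proof (rule Liminf_eq_Limsup[OF sequentially_bot])
  note lower = liminf_scaled_log_tail[OF assms] and upper = limsup_scaled_log_tail[of a]
    and mid = Liminf_le_Limsup[OF sequentially_bot, of "scaled_log_tail a"]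
  show "liminf (scaled_log_tail a) = - (SUP \<theta>\<in>{0<..}. ereal (\<theta> * a) - enn2ereal (cgf_integral D \<mu> t (tilt \<Delta> \<theta>)))"
    by (rule antisym[OF order_trans[OF mid upper] lower])
  show "limsup (scaled_log_tail a) = - (SUP \<theta>\<in>{0<..}. ereal (\<theta> * a) - enn2ereal (cgf_integral D \<mu> t (tilt \<Delta> \<theta>)))"
    by (rule antisym[OF upper order_trans[OF lower mid]])
qed

end

theorem mainTheorem6:
  fixes P :: "'a measure"
    and \<Lambda> :: "'a \<Rightarrow> real" and \<Lambda>s :: "nat \<Rightarrow> 'a \<Rightarrow> real"
    and Q :: "nat \<Rightarrow> 'a \<Rightarrow> nat"
    and f :: "real \<Rightarrow> ennreal"
    and \<Delta> \<mu> t a :: real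
  assumes "prob_space P"
    and nonneg: "AE \<omega> in P. 0 \<le> \<Lambda> \<omega>"
    and density: "distributed P lborel \<Lambda> f"
    and moment1: "integrable P \<Lambda>"
    and moment2: "integrable P (\<lambda>\<omega>. (\<Lambda> \<omega>)\<^sup>2)"
    and exp_moment: "\<exists>\<theta>>0. mgf P \<Lambda> \<theta> < \<infinity>"
    and indep: "prob_space.indep_vars P (\<lambda>_. borel) \<Lambda>s UNIV"
    and copies: "\<And>j. distr P borel (\<Lambda>s j) = distr P borel \<Lambda>"
    and queue: "\<And>N. N \<ge> 1 \<Longrightarrow>
          cond_poisson P \<Lambda>s (\<lambda>\<omega>. real N * kappa \<mu> t \<Delta> N (\<lambda>j. \<Lambda>s j \<omega>)) (Q N)"
    and "\<Delta> > 0" and "\<mu> > 0" and "t > 0"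
    and "a > prob_space.expectation P \<Lambda> / \<mu> * (1 - exp (- \<mu> * t))"
  shows "(\<lambda>N. ereal (\<Delta> / real N) *
              elog (emeasure P {\<omega> \<in> space P. real (Q N \<omega>) / real N \<ge> a}))
         \<longlonglongrightarrow> - (SUP \<theta>\<in>{0<..}. ereal (\<theta> * a) - log_mgf_integral P \<Lambda> \<mu> t \<Delta> \<theta>)"
proof -
  interpret prob_space P by fact
  have meas [measurable]: "\<Lambda> \<in> borel_measurable P" using moment1 by simp
  define D where "D = distr P borel \<Lambda>"
  \<comment> \<open>the density excludes an atom at zero\<close>
  have "AE x in lborel. 0 < f x \<longrightarrow> x \<noteq> 0"
    using AE_lborel_singleton[of "0 :: real"] by eventually_elim simp
  then have "AE \<omega> in P. \<Lambda> \<omega> \<noteq> 0"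
    by (subst distributed_AE2[OF density]) simp_all
  with nonneg have pos: "AE \<omega> in P. 0 < \<Lambda> \<omega>" by eventually_elim linarith
  have law: "positive_law D"
  proof -
    have "AE x in D. 0 < x" unfolding D_def by (subst AE_distr_iff) (use pos in simp_all)
    moreover have "prob_space D" unfolding D_def by (rule prob_space_distr) simp
    moreover have "sets D = sets borel" by (simp add: D_def)
    ultimately show ?thesis by (intro positive_law.intro positive_law_axioms.intro)
  qed
  have distr_D: "distr P borel (\<Lambda>s j) = D" for j unfolding D_def by (rule copies)
  interpret queue_model P \<Lambda>s Q D \<Delta> \<mu> t
    by (rule queue_model.intro[OF \<open>prob_space P\<close> queue_model_axioms.intro[OF law indep distr_D queue
          \<open>\<Delta> > 0\<close> \<open>\<mu> > 0\<close> \<open>t > 0\<close>]])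
  have mgf_D: "mgf P \<Lambda> y = restricted_mgf D UNIV y" for y
    unfolding mgf_def restricted_mgf_def D_def by (simp add: nn_integral_distr)
  have L: "log_mgf_integral P \<Lambda> \<mu> t \<Delta> \<theta> = enn2ereal (cgf_integral D \<mu> t (tilt \<Delta> \<theta>))" for \<theta>
    unfolding log_mgf_integral_def cgf_integral_def mgf_D tilt_def ..
  obtain y0 where y0: "0 < y0" "restricted_mgf D UNIV y0 < \<infinity>" using exp_moment unfolding mgf_D by blast
  have int: "integrable D (\<lambda>x. x)" unfolding D_def using moment1 by (simp add: integrable_distr_eq)
  have "prob_space.expectation D (\<lambda>x. x) = expectation \<Lambda>" unfolding D_def by (simp add: integral_distr)
  then have "prob_space.expectation D (\<lambda>x. x) / \<mu> * (1 - exp (- \<mu> * t)) < a"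
    using \<open>a > expectation \<Lambda> / \<mu> * (1 - exp (- \<mu> * t))\<close> by (simp only:)
  from scaled_log_tail_tendsto[OF int y0 this]
  show ?thesis unfolding scaled_log_tail_def[abs_def] L .
qed

end
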